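(* Let $X$ be a compact Hausdorff space, $\Delta_1\subset X$ clopen, $\alpha:\Delta_1\to X$ continuous with open image $\Delta_{-1}=\alpha(\Delta_1)$, $\mathcal{A}=C(X)$, and let $\delta:\mathcal{A}\to\mathcal{A}$ be the endomorphism $\delta(a)=a\circ\alpha$ on $\Delta_1$, $\delta(a)=0$ off $\Delta_1$. Suppose that $\alpha$ is topologically free. Then for every $(\pi,U,H)\in\mathrm{CovFaithRep}(\mathcal{A},\delta)$ the $C^*$-algebra $C^*(\pi(\mathcal{A}),U)$ generated by $\pi(\mathcal{A})$ and $U$ possesses property $( * )$: for all $M,N\in\mathbb{N}$ and all $a_k^{(n)}\in\mathcal{A}$, $$\Big\|\sum_{k=0}^M U^{*k}\pi(a_k^{(0)})U^k\Big\|\le\Big\|\sum_{n=-N}^N\Big(\sum_{k=0}^M U^{*k}\pi(a_k^{(n)})U^k\Big)U^n\Big\| .$$ In other words, for any two covariant faithful representations $(\pi_1,U_1,H_1)$ and $(\pi_2,U_2,H_2)$ of $(\mathcal{A},\delta)$, the mapping $$U_1\longmapsto U_2,\qquad \pi_1(a)\longmapsto\pi_2(a),\quad a\in\mathcal{A},$$ determines an isomorphism of $C^*(\pi_1(\mathcal{A}),U_1)$ onto $C^*(\pi_2(\mathcal{A}),U_2)$.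
   Context: $\mathbb{N}=\{0,1,2,\dots\}$. For a partial isometry $U$ and $n\in\mathbb{N}$, $U^{-n}:=U^{*n}$. For $n\ge1$, $\Delta_n$ is the domain of $\alpha^n$. For $K\subset X$, $C_K(X)$ denotes the continuous functions on $X$ vanishing outside $K$. Covariant representation: a covariant representation of $(\mathcal{A},\delta)$ is a triple $(\pi,U,H)$ where $\pi:\mathcal{A}\to L(H)$ is a representation of $\mathcal{A}$ on a Hilbert space $H$ and $U\in L(H)$ is a partial isometry whose initial space is $\pi(C_{\Delta_{-1}}(X))H$ and whose final space is $\pi(C_{\Delta_1}(X))H$, such that $U\pi(a)U^*=\pi(\delta(a))$ for all $a\in\mathcal{A}$. It is a covariant faithful representation if $\pi$ is faithful; $\mathrm{CovFaithRep}(\mathcal{A},\delta)$ is the set of covariant faithful representations. Topological freedom: for $n>0$ let $F_n=\{x\in\Delta_n:\alpha^n(x)=x\}$ and $\alpha^{-k}(x)=\{y\in\Delta_k:\alpha^k(y)=x\}$. The partial mapping $\alpha$ is topologically free if for every $n>0$, every open nonempty subset $V\subset F_n$ contains a point $x$ such that $|\alpha^{-k}(x)|>1$ for some $k\in\{1,\dots,n\}$. *)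

theory Defs
  imports "HOL-Analysis.Analysis"
begin

section \<open>Complex Hilbert spaces\<close>

class scaleC =
  fixes scaleC :: "complex \<Rightarrow> 'a \<Rightarrow> 'a"  (infixr \<open>*\<^sub>C\<close> 75)

class complex_vector = real_vector + scaleC +
  assumes scaleC_add_right: "c *\<^sub>C (x + y) = c *\<^sub>C x + c *\<^sub>C y"
    and scaleC_add_left: "(c + d) *\<^sub>C x = c *\<^sub>C x + d *\<^sub>C x"
    and scaleC_scaleC: "c *\<^sub>C d *\<^sub>C x = (c * d) *\<^sub>C x"
    and scaleR_scaleC: "r *\<^sub>R x = complex_of_real r *\<^sub>C x"

text \<open>The inner product \<^term>\<open>cinner\<close> is antilinear in its first and linear in its second
  argument.  Its real part is the real inner product of the library, so definiteness and
  norm x = sqrt (Re (cinner x x)) are inherited from \<^class>\<open>real_inner\<close>.\<close>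

class chilbert_space = complex_vector + real_inner + complete_space +
  fixes cinner :: "'a \<Rightarrow> 'a \<Rightarrow> complex"
  assumes cinner_commute: "cinner x y = cnj (cinner y x)"
    and cinner_add_right: "cinner x (y + z) = cinner x y + cinner x z"
    and cinner_scaleC_right: "cinner x (c *\<^sub>C y) = c * cinner x y"
    and inner_eq_Re_cinner: "inner x y = Re (cinner x y)"

instantiation complex :: chilbert_space
begin

definition scaleC_complex :: "complex \<Rightarrow> complex \<Rightarrow> complex"
  where "scaleC_complex c x = c * x"

definition cinner_complex :: "complex \<Rightarrow> complex \<Rightarrow> complex"
  where "cinner_complex x y = cnj x * y"

instance
  by standard (auto simp: scaleC_complex_def cinner_complex_def inner_complex_def
      algebra_simps scaleR_conv_of_real)

end

section \<open>Bounded operators on a Hilbert space\<close>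

typedef (overloaded) ('h::chilbert_space) bop =
  "{f :: 'h \<Rightarrow> 'h. bounded_linear f \<and> (\<forall>c x. f (c *\<^sub>C x) = c *\<^sub>C f x)}"
  morphisms bop_apply Bop
  by (rule exI[of _ "\<lambda>x. x"]) (simp add: bounded_linear_ident)

setup_lifting type_definition_bop

lemma complex_scaleC_zero: "c *\<^sub>C (0 :: 'h::complex_vector) = 0"
  using scaleC_add_right[of c 0 "0 :: 'h"] by simp

lemma complex_scaleC_diff: "c *\<^sub>C (x - y :: 'h::complex_vector) = c *\<^sub>C x - c *\<^sub>C y"
  using scaleC_add_right[of c "x - y" y] by (simp add: algebra_simps)

lemma complex_scaleC_minus: "c *\<^sub>C (- y :: 'h::complex_vector) = - (c *\<^sub>C y)"
  using complex_scaleC_diff[of c 0 y] by (simp add: complex_scaleC_zero)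

lemma cinner_self: "cinner x x = complex_of_real ((norm (x :: 'h::chilbert_space))\<^sup>2)"
proof -
  have "Im (cinner x x) = 0"
    using cinner_commute[of x x] by (metis cnj.simps(2) equal_neg_zero)
  then show ?thesis
    by (simp add: complex_eq_iff power2_norm_eq_inner inner_eq_Re_cinner)
qed

lemma norm_scaleC: "norm (c *\<^sub>C (x :: 'h::chilbert_space)) = cmod c * norm x"
proof -
  have "cinner (c *\<^sub>C x) (c *\<^sub>C x) = c * cnj (c * cnj (cinner x x))"
    by (metis cinner_commute cinner_scaleC_right)
  also have "\<dots> = (c * cnj c) * cinner x x"
    by (simp add: cinner_self)
  finally have "complex_of_real ((norm (c *\<^sub>C x))\<^sup>2) = complex_of_real ((cmod c * norm x)\<^sup>2)"
    by (simp add: cinner_self complex_norm_square power_mult_distrib flip: of_real_power)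
  then have "(norm (c *\<^sub>C x))\<^sup>2 = (cmod c * norm x)\<^sup>2"
    by (simp only: of_real_eq_iff)
  then show ?thesis
    by (simp add: power2_eq_iff_nonneg)
qed

lemma bounded_linear_scaleC: "bounded_linear (\<lambda>x :: 'h::chilbert_space. c *\<^sub>C x)"
  by (rule bounded_linear_intro[where K = "cmod c"])
    (simp_all add: scaleC_add_right scaleR_scaleC scaleC_scaleC norm_scaleC mult.commute)

instantiation bop :: (chilbert_space) real_normed_algebra
begin

lift_definition norm_bop :: "'a bop \<Rightarrow> real" is onorm .

lift_definition zero_bop :: "'a bop" is "\<lambda>x. 0"
  by (simp add: complex_scaleC_zero)

lift_definition plus_bop :: "'a bop \<Rightarrow> 'a bop \<Rightarrow> 'a bop" is "\<lambda>f g x. f x + g x"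
  by (simp add: bounded_linear_add scaleC_add_right)

lift_definition minus_bop :: "'a bop \<Rightarrow> 'a bop \<Rightarrow> 'a bop" is "\<lambda>f g x. f x - g x"
  by (simp add: bounded_linear_sub complex_scaleC_diff)

lift_definition uminus_bop :: "'a bop \<Rightarrow> 'a bop" is "\<lambda>f x. - f x"
  by (simp add: bounded_linear_minus complex_scaleC_minus)

lift_definition scaleR_bop :: "real \<Rightarrow> 'a bop \<Rightarrow> 'a bop" is "\<lambda>r f x. r *\<^sub>R f x"
  by (intro conjI bounded_linear_const_scaleR)
    (simp_all add: scaleR_scaleC scaleC_scaleC mult.commute)

lift_definition times_bop :: "'a bop \<Rightarrow> 'a bop \<Rightarrow> 'a bop" is "\<lambda>f g x. f (g x)"
  by (simp add: bounded_linear_compose)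

definition dist_bop :: "'a bop \<Rightarrow> 'a bop \<Rightarrow> real"
  where "dist_bop S T = norm (S - T)"

definition uniformity_bop :: "('a bop \<times> 'a bop) filter"
  where "uniformity_bop = (INF e\<in>{0 <..}. principal {(x, y). dist x y < e})"

definition open_bop :: "'a bop set \<Rightarrow> bool"
  where "open_bop S = (\<forall>x\<in>S. \<forall>\<^sub>F (x', y) in uniformity. x' = x \<longrightarrow> y \<in> S)"

definition sgn_bop :: "'a bop \<Rightarrow> 'a bop"
  where "sgn_bop T = inverse (norm T) *\<^sub>R T"

instance
proof
  fix R S T :: "'a bop" and r s :: real
  show "dist S T = norm (S - T)" by (rule dist_bop_def)
  show "sgn T = inverse (norm T) *\<^sub>R T" by (rule sgn_bop_def)
  show "uniformity = (INF e\<in>{0 <..}. principal {(x, y :: 'a bop). dist x y < e})"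
    by (rule uniformity_bop_def)
  show "open U = (\<forall>x\<in>U. \<forall>\<^sub>F (x', y) in uniformity. x' = x \<longrightarrow> y \<in> U)" for U :: "'a bop set"
    by (rule open_bop_def)
  show "R + S + T = R + (S + T)" by transfer (simp add: add.assoc)
  show "S + T = T + S" by transfer (simp add: add.commute)
  show "0 + T = T" by transfer simp
  show "- T + T = 0" by transfer simp
  show "S - T = S + - T" by transfer simp
  show "r *\<^sub>R (S + T) = r *\<^sub>R S + r *\<^sub>R T" by transfer (simp add: scaleR_add_right)
  show "(r + s) *\<^sub>R T = r *\<^sub>R T + s *\<^sub>R T" by transfer (simp add: scaleR_add_left)
  show "r *\<^sub>R s *\<^sub>R T = (r * s) *\<^sub>R T" by transfer simp
  show "1 *\<^sub>R T = T" by transfer simp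
  show "R * S * T = R * (S * T)" by transfer simp
  show "(R + S) * T = R * T + S * T" by transfer simp
  show "R * (S + T) = R * S + R * T" by transfer (auto simp: linear_simps)
  show "r *\<^sub>R S * T = r *\<^sub>R (S * T)" by transfer simp
  show "S * r *\<^sub>R T = r *\<^sub>R (S * T)" by transfer (auto simp: linear_simps)
  show "norm T = 0 \<longleftrightarrow> T = 0" by transfer (auto simp: onorm_eq_0)
  show "norm (S + T) \<le> norm S + norm T" by transfer (auto intro: onorm_triangle)
  show "norm (r *\<^sub>R T) = \<bar>r\<bar> * norm T" by transfer (auto intro: onorm_scaleR)
  show "norm (S * T) \<le> norm S * norm T"
    by transfer (use onorm_compose in \<open>auto simp: comp_def\<close>)
qed

end

text \<open>\<^typ>\<open>'h bop\<close> is not an instance of \<^class>\<open>real_normed_algebra_1\<close>, because the identity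
  has norm 0 when the Hilbert space is zero.\<close>

instantiation bop :: (chilbert_space) monoid_mult
begin

lift_definition one_bop :: "'a bop" is "\<lambda>x. x"
  by (simp add: bounded_linear_ident)

instance
  by standard (transfer, simp)+

end

instantiation bop :: (chilbert_space) complex_vector
begin

lift_definition scaleC_bop :: "complex \<Rightarrow> 'a bop \<Rightarrow> 'a bop" is "\<lambda>c f x. c *\<^sub>C f x"
  by (auto intro: bounded_linear_compose[OF bounded_linear_scaleC]
      simp: scaleC_scaleC mult.commute)

instance
  by standard (transfer, simp add: scaleC_add_left scaleC_add_right scaleC_scaleC scaleR_scaleC)+

end

definition adj :: "'h::chilbert_space bop \<Rightarrow> 'h bop"
  where "adj T = (THE S. \<forall>x y. cinner (bop_apply S x) y = cinner x (bop_apply T y))"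

definition zpow :: "'h::chilbert_space bop \<Rightarrow> int \<Rightarrow> 'h bop"
  where "zpow U n = (if 0 \<le> n then U ^ nat n else adj U ^ nat (- n))"

definition initial_space :: "'h::chilbert_space bop \<Rightarrow> 'h set"
  where "initial_space U = {x. \<forall>y. bop_apply U y = 0 \<longrightarrow> cinner x y = 0}"

definition final_space :: "'h::chilbert_space bop \<Rightarrow> 'h set"
  where "final_space U = range (bop_apply U)"

definition partial_isometry :: "'h::chilbert_space bop \<Rightarrow> bool"
  where "partial_isometry U \<longleftrightarrow> (\<forall>x\<in>initial_space U. norm (bop_apply U x) = norm x)"

definition star_subalgebra :: "'h::chilbert_space bop set \<Rightarrow> bool"
  where "star_subalgebra B \<longleftrightarrow> 0 \<in> B \<and>
    (\<forall>S\<in>B. \<forall>T\<in>B. S + T \<in> B \<and> S * T \<in> B) \<and>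
    (\<forall>c. \<forall>T\<in>B. c *\<^sub>C T \<in> B) \<and> (\<forall>T\<in>B. adj T \<in> B)"

definition cstar_generated :: "'h::chilbert_space bop set \<Rightarrow> 'h bop set"
  where "cstar_generated G = \<Inter>{B. star_subalgebra B \<and> closed B \<and> G \<subseteq> B}"

definition star_isomorphism ::
    "('h::chilbert_space bop \<Rightarrow> 'k::chilbert_space bop) \<Rightarrow> 'h bop set \<Rightarrow> 'k bop set \<Rightarrow> bool"
  where "star_isomorphism \<Phi> B C \<longleftrightarrow> bij_betw \<Phi> B C \<and>
    (\<forall>S\<in>B. \<forall>T\<in>B. \<Phi> (S + T) = \<Phi> S + \<Phi> T \<and> \<Phi> (S * T) = \<Phi> S * \<Phi> T) \<and>
    (\<forall>c. \<forall>T\<in>B. \<Phi> (c *\<^sub>C T) = c *\<^sub>C \<Phi> T) \<and> (\<forall>T\<in>B. \<Phi> (adj T) = adj (\<Phi> T))"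

section \<open>Partial dynamical systems\<close>

text \<open>A partial map is given by its domain \<open>D\<close> and a total function \<open>\<alpha>\<close> whose values
  outside \<open>D\<close> are irrelevant.\<close>

definition iter_dom :: "'x set \<Rightarrow> ('x \<Rightarrow> 'x) \<Rightarrow> nat \<Rightarrow> 'x set"
  where "iter_dom D \<alpha> n = {x. \<forall>i<n. (\<alpha> ^^ i) x \<in> D}"

definition iter_preimage :: "'x set \<Rightarrow> ('x \<Rightarrow> 'x) \<Rightarrow> nat \<Rightarrow> 'x \<Rightarrow> 'x set"
  where "iter_preimage D \<alpha> k x = {y \<in> iter_dom D \<alpha> k. (\<alpha> ^^ k) y = x}"

definition periodic_points :: "'x set \<Rightarrow> ('x \<Rightarrow> 'x) \<Rightarrow> nat \<Rightarrow> 'x set"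
  where "periodic_points D \<alpha> n = {x \<in> iter_dom D \<alpha> n. (\<alpha> ^^ n) x = x}"

text \<open>The sets \<open>V\<close> are open in the whole space, not relatively open in the set of
  periodic points.  As \<^const>\<open>card\<close> is 0 on infinite sets, those are listed separately.\<close>

definition topologically_free :: "'x::topological_space set \<Rightarrow> ('x \<Rightarrow> 'x) \<Rightarrow> bool"
  where "topologically_free D \<alpha> \<longleftrightarrow>
    (\<forall>n>0. \<forall>V. open V \<and> V \<noteq> {} \<and> V \<subseteq> periodic_points D \<alpha> n \<longrightarrow>
      (\<exists>x\<in>V. \<exists>k\<in>{1..n}. infinite (iter_preimage D \<alpha> k x) \<or> card (iter_preimage D \<alpha> k x) > 1))"

definition cont_fun :: "('x::topological_space \<Rightarrow> complex) set"
  where "cont_fun = {a. continuous_on UNIV a}"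

definition cont_fun_on :: "'x::topological_space set \<Rightarrow> ('x \<Rightarrow> complex) set"
  where "cont_fun_on K = {a \<in> cont_fun. \<forall>x. x \<notin> K \<longrightarrow> a x = 0}"

definition endo :: "'x set \<Rightarrow> ('x \<Rightarrow> 'x) \<Rightarrow> ('x \<Rightarrow> complex) \<Rightarrow> 'x \<Rightarrow> complex"
  where "endo D \<alpha> a = (\<lambda>x. if x \<in> D then a (\<alpha> x) else 0)"

section \<open>Covariant representations\<close>

text \<open>A representation is not required to be non-degenerate: \<open>\<pi> 1\<close> may be a proper projection.
  Only the values of \<open>\<pi>\<close> on \<^const>\<open>cont_fun\<close> matter.\<close>

definition representation ::
    "(('x::topological_space \<Rightarrow> complex) \<Rightarrow> 'h::chilbert_space bop) \<Rightarrow> bool"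
  where "representation \<pi> \<longleftrightarrow>
    (\<forall>a\<in>cont_fun. \<forall>b\<in>cont_fun.
      \<pi> (\<lambda>x. a x + b x) = \<pi> a + \<pi> b \<and> \<pi> (\<lambda>x. a x * b x) = \<pi> a * \<pi> b) \<and>
    (\<forall>c. \<forall>a\<in>cont_fun. \<pi> (\<lambda>x. c * a x) = c *\<^sub>C \<pi> a) \<and>
    (\<forall>a\<in>cont_fun. \<pi> (\<lambda>x. cnj (a x)) = adj (\<pi> a))"

definition covariant_representation ::
    "'x::topological_space set \<Rightarrow> ('x \<Rightarrow> 'x) \<Rightarrow>
      (('x \<Rightarrow> complex) \<Rightarrow> 'h::chilbert_space bop) \<Rightarrow> 'h bop \<Rightarrow> bool"
  where "covariant_representation D \<alpha> \<pi> U \<longleftrightarrow>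
    representation \<pi> \<and> partial_isometry U \<and>
    initial_space U = {bop_apply (\<pi> a) h |a h. a \<in> cont_fun_on (\<alpha> ` D)} \<and>
    final_space U = {bop_apply (\<pi> a) h |a h. a \<in> cont_fun_on D} \<and>
    (\<forall>a\<in>cont_fun. U * \<pi> a * adj U = \<pi> (endo D \<alpha> a))"

definition cov_faith_rep ::
    "'x::topological_space set \<Rightarrow> ('x \<Rightarrow> 'x) \<Rightarrow>
      (('x \<Rightarrow> complex) \<Rightarrow> 'h::chilbert_space bop) \<Rightarrow> 'h bop \<Rightarrow> bool"
  where "cov_faith_rep D \<alpha> \<pi> U \<longleftrightarrow>
    covariant_representation D \<alpha> \<pi> U \<and> inj_on \<pi> cont_fun"

definition property_star ::
    "(('x::topological_space \<Rightarrow> complex) \<Rightarrow> 'h::chilbert_space bop) \<Rightarrow> 'h bop \<Rightarrow> bool"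
  where "property_star \<pi> U \<longleftrightarrow>
    (\<forall>(M::nat) (N::nat) (a :: int \<Rightarrow> nat \<Rightarrow> 'x \<Rightarrow> complex).
      (\<forall>n\<in>{- int N..int N}. \<forall>k\<le>M. a n k \<in> cont_fun) \<longrightarrow>
      norm (\<Sum>k\<le>M. adj U ^ k * \<pi> (a 0 k) * U ^ k)
        \<le> norm (\<Sum>n = - int N..int N. (\<Sum>k\<le>M. adj U ^ k * \<pi> (a n k) * U ^ k) * zpow U n))"

end

(* The monomials U*^k pi(a) U^l span a *-algebra, graded by l - k, whose product and adjoint are given
   by formulas in C(X) that do not depend on the representation.  A degree 0 element
   b = sum_k U*^k pi(a_k) U^k acts on U*^N pi(h) U^N as multiplication of h by the function
   c_N = sum_{k<=N} delta^(N-k)(a_k), and cutting down by the projections U*^N (1 - U*U) U^N (N < M)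
   and U*^M U^M shows that the norm of b is the supremum of |c_N| on Delta_N - alpha(D) (N < M) and of
   |c_M| on Delta_M, since a faithful representation of C(X) is isometric.

   Topological freedom allows every such supremum to be approached at a point y that has no small
   period: if all points of an open set are periodic, then one of them has two k-th preimages, and one
   of these is off its orbit.  For a bump function f at y supported on a small enough set,
   g = U*^K pi(f) U^K satisfies g U^n g = 0 for small n > 0.  Hence g x g = g b g when b is the degree 0
   part of x, and |c_N(y)| <= norm x.  The element x may be taken in a second representation, so that
   the norm of b in one representation is at most the norm of x in the other.

   Since norm x^2 <= (2 N + 1)^2 norm (degree 0 part of x x* ) for x of degree at most N, norms in the
   two representations agree up to the factor 2 N + 1.  Applied to (x x* )^p with p = 2^n, this
   gives equality of the norms, and the correspondence of the spans extends to the closures. *)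

theory Submission
  imports Defs
begin

section \<open>Adjoints\<close>

text \<open>One operator may be written as a sum of monomials in many ways, and nothing is known
  beforehand about how the norm of such a sum depends on the representation. Degree, product and
  adjoint are therefore defined on formal lists of triples (k, a, l); the degree 0 part of an
  operator becomes meaningful only through the norm estimate. That estimate compares two
  representations from the outset, since the functions c_N belong to the list alone: equal
  representations give the inequality of the first claim, different ones the isomorphism. Freeness
  does not make a given point aperiodic; it may only provide an aperiodic preimage of a nearby
  point. This is harmless for c_M with M above all exponents, because passing from M to M + j
  composes c_M with the j-th iterate of \<alpha>. Points off the image of \<alpha> have no preimages
  to pass to, but they are never periodic. Representations may be degenerate, so \<pi> 1, which U
  absorbs on both sides, serves as the unit in place of the identity operator.\<close>

instance chilbert_space \<subseteq> banach ..

text \<open>The representing vector is the minimiser of \<open>(norm x)\<^sup>2 - 2 * f x\<close>; a minimising sequence is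
  Cauchy by the parallelogram law.\<close>

lemma riesz_real:
  fixes f :: "'a::{real_inner,complete_space} \<Rightarrow> real"
  assumes "bounded_linear f"
  shows "\<exists>z. \<forall>x. f x = inner z x"
proof -
  interpret f: bounded_linear f by fact
  define J where "J x = (norm x)\<^sup>2 - 2 * f x" for x
  obtain K where K: "\<And>x. norm (f x) \<le> norm x * K"
    using f.bounded by blast
  have lower: "- K\<^sup>2 \<le> J x" for x
  proof -
    have "f x \<le> norm x * K" using K[of x] by simp
    moreover have "0 \<le> (norm x - K)\<^sup>2" by simp
    ultimately show ?thesis unfolding J_def power2_diff by linarith
  qed
  define m where "m = (INF x. J x)"
  have bdd: "bdd_below (range J)" using lower by (auto intro!: bdd_belowI)
  have m_le: "m \<le> J x" for x unfolding m_def by (rule cINF_lower[OF bdd]) simp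
  have "\<exists>x. J x < m + inverse (real (Suc n))" for n
  proof -
    have "(INF x. J x) < m + inverse (real (Suc n))" by (simp add: m_def)
    then show ?thesis by (meson cINF_greatest UNIV_not_empty not_le)
  qed
  then obtain X where X: "\<And>n. J (X n) < m + inverse (real (Suc n))" by metis
  have par: "(norm (x - y))\<^sup>2 \<le> 2 * (J x - m) + 2 * (J y - m)" for x y
  proof -
    have "(norm (x - y))\<^sup>2 = 2 * J x + 2 * J y - 4 * J ((1/2) *\<^sub>R (x + y))"
      unfolding J_def
      by (simp add: f.add f.scaleR power2_norm_eq_inner algebra_simps inner_commute)
    then show ?thesis using m_le[of "(1/2) *\<^sub>R (x + y)"] by (smt (verit))
  qed
  have "Cauchy X"
  proof (rule metric_CauchyI)
    fix e :: real assume e: "0 < e"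
    obtain N where N: "inverse (real (Suc N)) < e\<^sup>2 / 4"
      using reals_Archimedean[of "e\<^sup>2 / 4"] e by auto
    have "dist (X i) (X j) < e" if "N \<le> i" "N \<le> j" for i j
    proof -
      have "inverse (real (Suc i)) \<le> inverse (real (Suc N))"
        "inverse (real (Suc j)) \<le> inverse (real (Suc N))"
        using that by (simp_all add: le_imp_inverse_le)
      moreover have "n < q" if "u \<le> w" "v \<le> w" "n \<le> 2 * (a - m) + 2 * (b - m)"
          "a < m + u" "b < m + v" "w < q / 4" for n q u v w a b :: real
        using that by argo
      ultimately have "(norm (X i - X j))\<^sup>2 < e\<^sup>2"
        using par[of "X i" "X j"] X[of i] X[of j] N by blast
      then show ?thesis using e by (simp add: dist_norm power2_less_imp_less)
    qed
    then show "\<exists>M. \<forall>i\<ge>M. \<forall>j\<ge>M. dist (X i) (X j) < e" by blast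
  qed
  then obtain z where z: "X \<longlonglongrightarrow> z" using Cauchy_convergent convergent_def by blast
  have "(\<lambda>n. J (X n)) \<longlonglongrightarrow> J z"
    unfolding J_def by (intro tendsto_intros z f.tendsto)
  moreover have "(\<lambda>n. m + inverse (real (Suc n))) \<longlonglongrightarrow> m + 0"
    by (intro tendsto_intros LIMSEQ_inverse_real_of_nat)
  ultimately have Jz: "J z \<le> m + 0"
    by (rule LIMSEQ_le) (use X less_imp_le in blast)
  have "f v = inner z v" for v
  proof -
    define c where "c = inner z v - f v"
    have quad: "0 \<le> 2 * t * c + t\<^sup>2 * (norm v)\<^sup>2" for t
    proof -
      have "J (z + t *\<^sub>R v) = J z + 2 * t * c + t\<^sup>2 * (norm v)\<^sup>2"
        unfolding J_def c_def
        by (simp add: f.add f.scaleR power2_norm_eq_inner inner_commute algebra_simps)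
          (simp add: power2_eq_square)
      then show ?thesis using m_le[of "z + t *\<^sub>R v"] Jz by linarith
    qed
    show ?thesis
    proof (cases "v = 0")
      case True
      then show ?thesis by (simp add: f.zero)
    next
      case False
      define w where "w = (norm v)\<^sup>2"
      have "0 < w" using False by (simp add: w_def)
      \<comment> \<open>The value t = - c / w minimises the quadratic, and the minimum is negative
        unless c = 0.\<close>
      have "0 \<le> 2 * (- c / w) * c + (- c / w)\<^sup>2 * w" using quad w_def by blast
      also have "\<dots> = - c\<^sup>2 / w"
        using \<open>0 < w\<close> by (simp add: field_simps power2_eq_square)
      finally have "c = 0" using \<open>0 < w\<close>
        by (metis divide_less_0_iff less_le_not_le neg_less_0_iff_less zero_less_power2)
      then show ?thesis by (simp add: c_def)
    qed
  qed
  then show ?thesis by blast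
qed

section \<open>Evaluation of operators and existence of adjoints\<close>

lemma bop_ext: "(\<And>x. bop_apply S x = bop_apply T x) \<Longrightarrow> S = T"
  by (metis bop_apply_inject ext)

lemma bop_bounded_linear: "bounded_linear (bop_apply T)"
  using bop_apply[of T] by simp

lemma bop_apply_scaleC: "bop_apply T (c *\<^sub>C x) = c *\<^sub>C bop_apply T x"
  using bop_apply[of T] by simp

lemma bop_apply_simps [simp]:
  "bop_apply (S + T) x = bop_apply S x + bop_apply T x"
  "bop_apply (S - T) x = bop_apply S x - bop_apply T x"
  "bop_apply (- T) x = - bop_apply T x"
  "bop_apply (S * T) x = bop_apply S (bop_apply T x)"
  "bop_apply 0 x = 0"
  "bop_apply 1 x = x"
  "bop_apply (c *\<^sub>C T) x = c *\<^sub>C bop_apply T x"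
  by (simp_all add: plus_bop.rep_eq minus_bop.rep_eq uminus_bop.rep_eq times_bop.rep_eq
      zero_bop.rep_eq one_bop.rep_eq scaleC_bop.rep_eq)

lemma bop_apply_linear [simp]:
  "bop_apply T (x + y) = bop_apply T x + bop_apply T y"
  "bop_apply T (x - y) = bop_apply T x - bop_apply T y"
  "bop_apply T 0 = 0"
  using bop_bounded_linear[of T] by (simp_all add: linear_simps)

lemma norm_bop_apply_le: "norm (bop_apply T x) \<le> norm T * norm x"
  unfolding norm_bop.rep_eq by (rule onorm[OF bop_bounded_linear])

lemma norm_bop_leI: "0 \<le> c \<Longrightarrow> (\<And>x. norm (bop_apply T x) \<le> c * norm x) \<Longrightarrow> norm T \<le> c"
  unfolding norm_bop.rep_eq by (rule onorm_bound)

lemma cinner_add_left: "cinner (x + y) z = cinner x z + cinner (y :: 'h::chilbert_space) z"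
  by (metis cinner_add_right cinner_commute complex_cnj_add)

lemma cinner_scaleC_left: "cinner (c *\<^sub>C x) y = cnj c * cinner x (y :: 'h::chilbert_space)"
  by (metis cinner_commute cinner_scaleC_right complex_cnj_mult)

lemma cinner_zero_right [simp]: "cinner x (0 :: 'h::chilbert_space) = 0"
  using cinner_add_right[of x 0 0] by simp

lemma cinner_zero_left [simp]: "cinner (0 :: 'h::chilbert_space) x = 0"
  using cinner_add_left[of 0 0 x] by simp

lemma cinner_diff_right: "cinner x (y - z) = cinner x y - cinner x (z :: 'h::chilbert_space)"
  using cinner_add_right[of x "y - z" z] by simp

lemma cinner_diff_left: "cinner (x - y) z = cinner x z - cinner (y :: 'h::chilbert_space) z"
  using cinner_add_left[of "x - y" y z] by simp

lemma norm_eq_cinner: "complex_of_real ((norm x)\<^sup>2) = cinner x (x :: 'h::chilbert_space)"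
  by (simp add: cinner_self)

lemma cinner_ext: "(\<And>y. cinner x y = cinner z y) \<Longrightarrow> x = (z :: 'h::chilbert_space)"
  by (metis cinner_diff_left cinner_self diff_self eq_iff_diff_eq_0 norm_eq_zero of_real_eq_0_iff
      power_eq_0_iff)

lemma inner_scaleC_i: "inner x ((- \<i>) *\<^sub>C y) = Im (cinner x (y :: 'h::chilbert_space))"
  by (simp add: inner_eq_Re_cinner cinner_scaleC_right)

text \<open>The real Riesz lemma matches real parts only. Since T is complex linear, the same
  identity at \<open>(- \<i>) *\<^sub>C y\<close> matches the imaginary parts.\<close>

lemma adjoint_exists: "\<exists>S. \<forall>x y. cinner (bop_apply S x) y = cinner x (bop_apply T y)"
proof -
  interpret T: bounded_linear "bop_apply T" by (rule bop_bounded_linear)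
  have "\<exists>z. \<forall>y. cinner z y = cinner x (bop_apply T y)" for x
  proof -
    obtain z where z: "\<And>y. inner x (bop_apply T y) = inner z y"
      using riesz_real[OF bounded_linear_compose[OF bounded_linear_inner_right bop_bounded_linear]]
      by metis
    have "cinner z y = cinner x (bop_apply T y)" for y
    proof (rule complex_eqI)
      show "Re (cinner z y) = Re (cinner x (bop_apply T y))"
        using z[of y] by (simp only: inner_eq_Re_cinner)
      show "Im (cinner z y) = Im (cinner x (bop_apply T y))"
        using z[of "(- \<i>) *\<^sub>C y"] by (simp only: bop_apply_scaleC inner_scaleC_i)
    qed
    then show ?thesis by blast
  qed
  then obtain S where S: "\<And>x y. cinner (S x) y = cinner x (bop_apply T y)" by metis
  have add: "S (x + y) = S x + S y" and scale: "S (c *\<^sub>C x) = c *\<^sub>C S x" for x y c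
    by (rule cinner_ext, simp add: S cinner_add_left cinner_scaleC_left)+
  have bound: "norm (S x) \<le> norm x * norm T" for x
  proof -
    have "(norm (S x))\<^sup>2 = inner x (bop_apply T (S x))"
      using S[of x "S x"] by (simp add: power2_norm_eq_inner inner_eq_Re_cinner)
    also have "\<dots> \<le> norm x * norm (bop_apply T (S x))" by (rule norm_cauchy_schwarz)
    also have "\<dots> \<le> norm x * (norm T * norm (S x))"
      by (intro mult_left_mono norm_bop_apply_le norm_ge_zero)
    finally have "norm (S x) * norm (S x) \<le> (norm x * norm T) * norm (S x)"
      by (simp add: power2_eq_square mult.assoc)
    then show ?thesis
      by (cases "S x = 0") auto
  qed
  have "bounded_linear S"
    by (rule bounded_linear_intro[OF add _ bound]) (simp add: scaleR_scaleC scale)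
  then have "bop_apply (Bop S) = S" by (simp add: Bop_inverse scale)
  then show ?thesis using S by metis
qed

lemma cinner_adj_left: "cinner (bop_apply (adj T) x) y = cinner x (bop_apply T y)"
proof -
  have "\<exists>!S. \<forall>x y. cinner (bop_apply S x) y = cinner x (bop_apply T y)"
  proof (rule ex_ex1I[OF adjoint_exists])
    fix S S' assume "\<forall>x y. cinner (bop_apply S x) y = cinner x (bop_apply T y)"
      "\<forall>x y. cinner (bop_apply S' x) y = cinner x (bop_apply T y)"
    then show "S = S'" by (metis bop_ext cinner_ext)
  qed
  from theI'[OF this] show ?thesis unfolding adj_def by blast
qed

lemma cinner_adj_right: "cinner x (bop_apply (adj T) y) = cinner (bop_apply T x) y"
  by (metis cinner_adj_left cinner_commute)

lemma adj_eqI: "(\<And>x y. cinner (bop_apply S x) y = cinner x (bop_apply T y)) \<Longrightarrow> adj T = S"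
  by (rule bop_ext, rule cinner_ext) (simp add: cinner_adj_left)

lemma adj_adj [simp]: "adj (adj T) = T"
  by (rule adj_eqI) (simp add: cinner_adj_right)

lemma adj_add [simp]: "adj (S + T) = adj S + adj T"
  by (rule adj_eqI) (simp add: cinner_adj_left cinner_add_left cinner_add_right)

lemma adj_diff [simp]: "adj (S - T) = adj S - adj T"
  by (rule adj_eqI) (simp add: cinner_adj_left cinner_diff_left cinner_diff_right)

lemma adj_mult [simp]: "adj (S * T) = adj T * adj S"
  by (rule adj_eqI) (simp add: cinner_adj_left)

lemma adj_zero [simp]: "adj 0 = 0"
  by (rule adj_eqI) simp

lemma adj_one [simp]: "adj 1 = 1"
  by (rule adj_eqI) simp

lemma adj_scaleC [simp]: "adj (c *\<^sub>C T) = cnj c *\<^sub>C adj T"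
  by (rule adj_eqI) (simp add: cinner_adj_left cinner_scaleC_left cinner_scaleC_right)

lemma adj_power [simp]: "adj (T ^ n) = adj T ^ n"
  by (induction n) (simp_all add: power_commutes)

section \<open>The C*-identity and polarisation\<close>

lemma norm_apply_sq_le:
  "(norm (bop_apply T x))\<^sup>2 \<le> norm (adj T * T) * (norm x)\<^sup>2"
proof -
  have "(norm (bop_apply T x))\<^sup>2 = inner x (bop_apply (adj T * T) x)"
    by (simp add: power2_norm_eq_inner inner_eq_Re_cinner cinner_adj_right)
  also have "\<dots> \<le> norm x * norm (bop_apply (adj T * T) x)" by (rule norm_cauchy_schwarz)
  also have "\<dots> \<le> norm x * (norm (adj T * T) * norm x)"
    by (intro mult_left_mono norm_bop_apply_le norm_ge_zero)
  finally show ?thesis by (simp add: power2_eq_square mult_ac)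
qed

lemma norm_sq_le_norm_adj_mult: "(norm T)\<^sup>2 \<le> norm (adj T * T)"
proof -
  have "norm T \<le> sqrt (norm (adj T * T))"
  proof (rule norm_bop_leI)
    fix x
    have "norm (bop_apply T x) = sqrt ((norm (bop_apply T x))\<^sup>2)" by simp
    also have "\<dots> \<le> sqrt (norm (adj T * T) * (norm x)\<^sup>2)"
      by (rule real_sqrt_le_mono[OF norm_apply_sq_le])
    finally show "norm (bop_apply T x) \<le> sqrt (norm (adj T * T)) * norm x"
      by (simp add: real_sqrt_mult)
  qed simp
  then have "(norm T)\<^sup>2 \<le> (sqrt (norm (adj T * T)))\<^sup>2" by (rule power_mono) simp
  then show ?thesis by simp
qed

text \<open>The inequality \<open>norm_sq_le_norm_adj_mult\<close> and submultiplicativity let one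
  factor norm S be cancelled; the adjoint in place of S gives the reverse estimate.\<close>

lemma norm_adj [simp]: "norm (adj T) = norm T"
proof -
  have *: "norm S \<le> norm (adj S)" for S :: "'a bop"
  proof -
    have "norm S * norm S \<le> norm (adj S) * norm S"
      using norm_sq_le_norm_adj_mult[of S] norm_mult_ineq[of "adj S" S]
      by (simp add: power2_eq_square)
    then show ?thesis by (cases "S = 0") auto
  qed
  show ?thesis using *[of T] *[of "adj T"] by simp
qed

lemma norm_adj_mult: "norm (adj T * T) = (norm T)\<^sup>2"
  using norm_sq_le_norm_adj_mult[of T] norm_mult_ineq[of "adj T" T]
  by (simp add: power2_eq_square)

lemma norm_mult_adj: "norm (T * adj T) = (norm T)\<^sup>2"
  using norm_adj_mult[of "adj T"] by simp

text \<open>Polarisation: the vectors y + x and y + i x yield the sum and the difference of the two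
  mixed terms. The scalar i is essential, as a real rotation by a right angle shows.\<close>

lemma bop_zero_of_quadratic_form:
  assumes "\<And>x. cinner x (bop_apply T x) = 0"
  shows "T = 0"
proof (rule bop_ext)
  fix x
  have "cinner y (bop_apply T x) = 0" for y
  proof -
    have 1: "cinner y (bop_apply T x) + cinner x (bop_apply T y) = 0"
      using assms[of "y + x"] by (simp add: cinner_add_left cinner_add_right assms add.commute)
    have "cinner y (bop_apply T x) - cinner x (bop_apply T y) = 0"
      using assms[of "y + \<i> *\<^sub>C x"] assms[of x]
      by (simp add: cinner_add_left cinner_add_right assms bop_apply_scaleC
          cinner_scaleC_left cinner_scaleC_right)
    with 1 show ?thesis by simp
  qed
  then show "bop_apply T x = bop_apply 0 x"
    by (metis bop_apply_simps(5) cinner_commute cinner_ext cinner_zero_right)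
qed

text \<open>The norm is that of the real bounded operators, which form a complete space, and complex
  linearity survives pointwise limits. Completeness later carries the correspondence of the spans
  over to their closures.\<close>

instance bop :: (chilbert_space) banach
proof
  fix X :: "nat \<Rightarrow> 'a bop" assume X: "Cauchy X"
  define B where "B n = Blinfun (bop_apply (X n))" for n
  have B: "blinfun_apply (B n) = bop_apply (X n)" for n
    unfolding B_def by (rule bounded_linear_Blinfun_apply[OF bop_bounded_linear])
  have "norm (B i - B j) = norm (X i - X j)" for i j
    by (simp add: norm_blinfun.rep_eq norm_bop.rep_eq minus_blinfun.rep_eq B minus_bop.rep_eq)
  then have "Cauchy B" using X by (simp add: Cauchy_def dist_norm)
  then obtain L where L: "B \<longlonglongrightarrow> L" using Cauchy_convergent convergent_def by blast
  have lin: "blinfun_apply L (c *\<^sub>C x) = c *\<^sub>C blinfun_apply L x" for c x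
  proof (rule LIMSEQ_unique)
    show "(\<lambda>n. blinfun_apply (B n) (c *\<^sub>C x)) \<longlonglongrightarrow> blinfun_apply L (c *\<^sub>C x)"
      by (intro blinfun.tendsto L tendsto_const)
    have "(\<lambda>n. c *\<^sub>C blinfun_apply (B n) x) \<longlonglongrightarrow> c *\<^sub>C blinfun_apply L x"
      by (intro bounded_linear.tendsto[OF bounded_linear_scaleC] blinfun.tendsto L tendsto_const)
    then show "(\<lambda>n. blinfun_apply (B n) (c *\<^sub>C x)) \<longlonglongrightarrow> c *\<^sub>C blinfun_apply L x"
      by (simp add: B bop_apply_scaleC)
  qed
  define T where "T = Bop (blinfun_apply L)"
  have T: "bop_apply T = blinfun_apply L"
    unfolding T_def by (rule Bop_inverse) (simp add: lin blinfun.bounded_linear_right)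
  have "norm (X n - T) = norm (B n - L)" for n
    by (simp add: norm_blinfun.rep_eq norm_bop.rep_eq minus_blinfun.rep_eq B minus_bop.rep_eq T)
  then have "X \<longlonglongrightarrow> T"
    using L by (simp add: LIMSEQ_iff)
  then show "convergent X" by (auto simp: convergent_def)
qed

lemma bounded_linear_adj: "bounded_linear adj"
  by (rule bounded_linear_intro[where K = 1])
    (simp_all, metis adj_scaleC complex_cnj_complex_of_real scaleR_scaleC)

lemma bounded_linear_bop_scaleC: "bounded_linear (\<lambda>T :: 'h::chilbert_space bop. c *\<^sub>C T)"
proof (rule bounded_linear_intro[where K = "cmod c"])
  show "norm (c *\<^sub>C T) \<le> norm T * cmod c" for T :: "'h bop"
  proof (rule norm_bop_leI)
    fix x show "norm (bop_apply (c *\<^sub>C T) x) \<le> norm T * cmod c * norm x"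
      using mult_left_mono[OF norm_bop_apply_le[of T x], of "cmod c"]
      by (simp add: norm_scaleC mult_ac)
  qed simp
qed (simp_all add: scaleC_add_right scaleR_scaleC scaleC_scaleC mult.commute)

section \<open>Partial dynamical systems\<close>

lemma cont_fun_const [simp]: "(\<lambda>x. c) \<in> cont_fun"
  by (simp add: cont_fun_def)

lemma cont_fun_add: "a \<in> cont_fun \<Longrightarrow> b \<in> cont_fun \<Longrightarrow> (\<lambda>x. a x + b x) \<in> cont_fun"
  by (simp add: cont_fun_def continuous_on_add)

lemma cont_fun_diff: "a \<in> cont_fun \<Longrightarrow> b \<in> cont_fun \<Longrightarrow> (\<lambda>x. a x - b x) \<in> cont_fun"
  by (simp add: cont_fun_def continuous_on_diff)

lemma cont_fun_mult: "a \<in> cont_fun \<Longrightarrow> b \<in> cont_fun \<Longrightarrow> (\<lambda>x. a x * b x) \<in> cont_fun"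
  by (simp add: cont_fun_def continuous_on_mult)

lemma cont_fun_cnj: "a \<in> cont_fun \<Longrightarrow> (\<lambda>x. cnj (a x)) \<in> cont_fun"
  by (simp add: cont_fun_def continuous_on_cnj)

lemma cont_fun_of_real: "continuous_on UNIV u \<Longrightarrow> (\<lambda>x. complex_of_real (u x)) \<in> cont_fun"
  by (simp add: cont_fun_def continuous_on_of_real)

lemma continuous_on_norm_cont_fun: "a \<in> cont_fun \<Longrightarrow> continuous_on UNIV (\<lambda>x. cmod (a x))"
  by (simp add: cont_fun_def continuous_on_norm)

definition chi :: "'x set \<Rightarrow> 'x \<Rightarrow> complex"
  where "chi S x = (if x \<in> S then 1 else 0)"

lemma continuous_on_clopen_cases:
  assumes "open S" "closed S" "continuous_on S f" "continuous_on (- S) g"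
  shows "continuous_on UNIV (\<lambda>x. if x \<in> S then f x else g x)"
proof -
  have "continuous_on (S \<union> - S) (\<lambda>x. if x \<in> S then f x else g x)"
    by (rule continuous_on_cases) (use assms in auto)
  then show ?thesis by simp
qed

lemma cont_fun_chi: "open S \<Longrightarrow> closed S \<Longrightarrow> chi S \<in> cont_fun"
  unfolding cont_fun_def chi_def[abs_def]
  by (simp add: continuous_on_clopen_cases continuous_on_const)

lemma endo_power_apply:
  "(endo D \<alpha> ^^ n) a x = (if x \<in> iter_dom D \<alpha> n then a ((\<alpha> ^^ n) x) else 0)"
proof (induction n arbitrary: x)
  case 0
  then show ?case by (simp add: iter_dom_def)
next
  case (Suc n)
  have "x \<in> iter_dom D \<alpha> (Suc n) \<longleftrightarrow> x \<in> D \<and> \<alpha> x \<in> iter_dom D \<alpha> n"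
    unfolding iter_dom_def mem_Collect_eq All_less_Suc2 by (simp add: funpow_swap1)
  moreover have "(endo D \<alpha> ^^ Suc n) a x = (if x \<in> D then (endo D \<alpha> ^^ n) a (\<alpha> x) else 0)"
    by (simp add: endo_def[of D \<alpha> "(endo D \<alpha> ^^ n) a"])
  ultimately show ?case by (simp only: Suc funpow_Suc_right comp_apply) auto
qed

lemma iter_dom_0 [simp]: "iter_dom D \<alpha> 0 = UNIV"
  by (simp add: iter_dom_def)

lemma iter_dom_add: "x \<in> iter_dom D \<alpha> (m + n) \<longleftrightarrow> x \<in> iter_dom D \<alpha> m \<and> (\<alpha> ^^ m) x \<in> iter_dom D \<alpha> n"
proof
  assume x: "x \<in> iter_dom D \<alpha> (m + n)"
  have "(\<alpha> ^^ i) ((\<alpha> ^^ m) x) \<in> D" if "i < n" for i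
  proof -
    have "(\<alpha> ^^ (i + m)) x \<in> D" using x that by (simp add: iter_dom_def)
    then show ?thesis by (simp add: funpow_add)
  qed
  then show "x \<in> iter_dom D \<alpha> m \<and> (\<alpha> ^^ m) x \<in> iter_dom D \<alpha> n"
    using x by (simp add: iter_dom_def)
next
  assume x: "x \<in> iter_dom D \<alpha> m \<and> (\<alpha> ^^ m) x \<in> iter_dom D \<alpha> n"
  have "(\<alpha> ^^ i) x \<in> D" if "i < m + n" for i
  proof (cases "i < m")
    case False
    then have "(\<alpha> ^^ (i - m)) ((\<alpha> ^^ m) x) \<in> D" using x that by (simp add: iter_dom_def)
    moreover have "(\<alpha> ^^ (i - m)) ((\<alpha> ^^ m) x) = (\<alpha> ^^ ((i - m) + m)) x"
      by (simp only: funpow_add comp_apply)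
    ultimately show ?thesis using False by simp
  qed (use x in \<open>simp add: iter_dom_def\<close>)
  then show "x \<in> iter_dom D \<alpha> (m + n)" by (simp add: iter_dom_def)
qed

lemma iter_dom_antimono: "m \<le> n \<Longrightarrow> x \<in> iter_dom D \<alpha> n \<Longrightarrow> x \<in> iter_dom D \<alpha> m"
  by (auto simp: iter_dom_def)

text \<open>The orbit repeats after m steps, so its first m points, which lie in D, are all of
  it.\<close>

lemma periodic_points_dvd:
  assumes "x \<in> periodic_points D \<alpha> m" "0 < m" "m dvd n"
  shows "x \<in> periodic_points D \<alpha> n"
proof -
  have per: "(\<alpha> ^^ (i mod m)) x = (\<alpha> ^^ i) x" for i
    using assms by (simp add: periodic_points_def funpow_mod_eq)
  have "(\<alpha> ^^ i) x \<in> D" for i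
    using assms per[of i] mod_less_divisor[OF \<open>0 < m\<close>, of i]
    unfolding periodic_points_def iter_dom_def by auto
  moreover have "(\<alpha> ^^ n) x = x"
    using per[of n] \<open>m dvd n\<close> by simp
  ultimately show ?thesis by (simp add: periodic_points_def iter_dom_def)
qed

text \<open>If all points of the open set have a period at most \<open>N\<close>, they have the common period
  \<open>fact N\<close>, so freeness yields a point with two \<open>k\<close>-th preimages; at most one of these
  lies on the orbit of the point, and the other one is not periodic.\<close>

lemma topologically_free_aperiodic:
  assumes free: "topologically_free D \<alpha>" and O: "open V" "V \<noteq> {}"
  obtains k y where "y \<in> iter_dom D \<alpha> k" "(\<alpha> ^^ k) y \<in> V"
    "\<And>n. 1 \<le> n \<Longrightarrow> n \<le> N \<Longrightarrow> y \<notin> periodic_points D \<alpha> n"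
proof -
  define p :: nat where "p = fact N"
  have p: "y \<in> periodic_points D \<alpha> p" if "1 \<le> n" "n \<le> N" "y \<in> periodic_points D \<alpha> n" for n y
    using that periodic_points_dvd[of y D \<alpha> n p] by (simp add: p_def dvd_fact)
  show ?thesis
  proof (cases "V \<subseteq> periodic_points D \<alpha> p")
    case False
    then obtain x where "x \<in> V" "x \<notin> periodic_points D \<alpha> p" by blast
    then show ?thesis using that[of x 0] p by auto
  next
    case True
    have "p > 0" by (simp add: p_def)
    then obtain x k where x: "x \<in> V" "k \<in> {1..p}"
      "infinite (iter_preimage D \<alpha> k x) \<or> card (iter_preimage D \<alpha> k x) > 1"
      using free O True unfolding topologically_free_def by meson
    have "\<not> (\<exists>z. iter_preimage D \<alpha> k x \<subseteq> {z})"
      using x(3) by (metis card_mono card.empty card_insert_disjoint finite.emptyI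
          finite_insert finite_subset insert_absorb not_le One_nat_def empty_iff)
    then obtain y z where yz: "y \<in> iter_preimage D \<alpha> k x" "z \<in> iter_preimage D \<alpha> k x" "y \<noteq> z"
      by blast
    \<comment> \<open>A periodic w returns to itself after p * k steps, and the first k of them lead
      to x. The remaining steps start from x, so w is determined by x alone.\<close>
    have ret: "w = (\<alpha> ^^ (p * k - k)) x" if "w \<in> iter_preimage D \<alpha> k x" "w \<in> periodic_points D \<alpha> p" for w
    proof -
      have "(\<alpha> ^^ (p * k)) w = w"
        using periodic_points_dvd[OF that(2) \<open>p > 0\<close>, of "p * k"] by (simp add: periodic_points_def)
      moreover have "(\<alpha> ^^ (p * k)) w = (\<alpha> ^^ ((p * k - k) + k)) w"
        using \<open>p > 0\<close> by simp
      ultimately show ?thesis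
        using that(1) by (simp only: funpow_add comp_apply iter_preimage_def mem_Collect_eq)
    qed
    obtain w where w: "w \<in> iter_preimage D \<alpha> k x" "w \<notin> periodic_points D \<alpha> p"
      using yz ret by metis
    then show ?thesis using that[of w k] p x(1) by (auto simp: iter_preimage_def)
  qed
qed

section \<open>Bump functions and the clopen domains of the iterates\<close>

lemma compact_t2_bump:
  fixes y :: "'x::t2_space"
  assumes "compact (UNIV :: 'x set)" "open W" "y \<in> W"
  obtains u :: "'x \<Rightarrow> real" where "continuous_on UNIV u" "\<And>x. 0 \<le> u x" "\<And>x. u x \<le> 1"
    "u y = 1" "\<And>x. x \<notin> W \<Longrightarrow> u x = 0"
proof -
  have "Hausdorff_space (euclidean :: 'x topology)"
    unfolding Hausdorff_space_def disjnt_def open_openin[symmetric] using hausdorff by blast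
  then have "normal_space (euclidean :: 'x topology)"
    using assms(1) by (simp add: compact_Hausdorff_or_regular_imp_normal_space compact_space_def)
  moreover have "closedin euclidean (- W)" "closedin euclidean {y}"
    using assms by (simp_all add: closed_Compl flip: closed_closedin)
  moreover have "disjnt (- W) {y}" using assms(3) by simp
  ultimately obtain u where u: "continuous_map euclidean (top_of_set {0..1::real}) u"
    "u ` (- W) \<subseteq> {0}" "u ` {y} \<subseteq> {1}"
    by (rule Urysohn_lemma[where a = 0 and b = 1]) simp_all
  show ?thesis
  proof (rule that[of u])
    show "continuous_on UNIV u" using u(1) by (simp add: continuous_map_in_subtopology)
    have "u x \<in> {0..1}" for x using u(1) by (auto simp: continuous_map_in_subtopology)
    then show "\<And>x. 0 \<le> u x" "\<And>x. u x \<le> 1" by auto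
  qed (use u in auto)
qed

locale partial_system =
  fixes D :: "'x::t2_space set" and \<alpha> :: "'x \<Rightarrow> 'x"
  assumes compact_space: "compact (UNIV :: 'x set)"
    and open_dom: "open D" and closed_dom: "closed D"
    and cont: "continuous_on D \<alpha>" and open_image: "open (\<alpha> ` D)"
begin

abbreviation \<delta> where "\<delta> \<equiv> endo D \<alpha>"

abbreviation \<Delta> where "\<Delta> \<equiv> iter_dom D \<alpha>"

text \<open>D is compact, hence so is its image. The image being clopen, its indicator function is
  continuous and can represent the initial projection of U.\<close>

lemma closed_image: "closed (\<alpha> ` D)"
proof -
  have "compact D" using compact_space closed_dom by (metis compact_Int_closed inf_top_left)
  then show ?thesis using cont by (simp add: compact_continuous_image compact_imp_closed)
qed

lemma endo_cont: "a \<in> cont_fun \<Longrightarrow> \<delta> a \<in> cont_fun"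
proof -
  assume "a \<in> cont_fun"
  then have "continuous_on D (\<lambda>x. a (\<alpha> x))"
    unfolding cont_fun_def
    using continuous_on_compose2[OF _ cont, of UNIV a] by simp
  then show "\<delta> a \<in> cont_fun"
    unfolding cont_fun_def endo_def
    by (simp add: continuous_on_clopen_cases open_dom closed_dom continuous_on_const)
qed

lemma endo_power_cont: "a \<in> cont_fun \<Longrightarrow> (\<delta> ^^ n) a \<in> cont_fun"
  by (induction n) (simp_all add: endo_cont)

lemma endo_power_one: "(\<delta> ^^ n) (\<lambda>x. 1) = chi (\<Delta> n)"
  by (rule ext) (simp add: endo_power_apply chi_def)

lemma chi_iter_dom_cont: "chi (\<Delta> n) \<in> cont_fun"
  using endo_power_cont[of "\<lambda>x. 1" n] by (simp add: endo_power_one)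

text \<open>The indicator of \<Delta> n is the n-th power of \<delta> applied to 1, hence
  continuous; its level sets show that \<Delta> n is open and closed.\<close>

lemma open_iter_dom: "open (\<Delta> n)"
proof -
  have "open {x. chi (\<Delta> n) x \<noteq> 0}"
    using chi_iter_dom_cont[of n] unfolding cont_fun_def
    by (intro open_Collect_neq) auto
  moreover have "{x. chi (\<Delta> n) x \<noteq> 0} = \<Delta> n" by (auto simp: chi_def)
  ultimately show ?thesis by simp
qed

lemma closed_iter_dom: "closed (\<Delta> n)"
proof -
  have "closed {x. chi (\<Delta> n) x = 1}"
    using chi_iter_dom_cont[of n] unfolding cont_fun_def
    by (intro closed_Collect_eq) auto
  moreover have "{x. chi (\<Delta> n) x = 1} = \<Delta> n" by (auto simp: chi_def)
  ultimately show ?thesis by simp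
qed

text \<open>For each of the finitely many n the point y has a neighbourhood that the n-th iterate
  maps off itself: the complement of the closed set \<Delta> n if the iterate is undefined at y, and
  otherwise a set cut out by a function separating y from its n-th image. The bump is supported in
  the intersection of these sets with W.\<close>

lemma aperiodic_bump:
  assumes W: "open W" "y \<in> W"
    and y: "\<And>n. 1 \<le> n \<Longrightarrow> n \<le> N \<Longrightarrow> y \<notin> periodic_points D \<alpha> n"
  obtains u :: "'x \<Rightarrow> real" where "continuous_on UNIV u" "\<And>x. 0 \<le> u x" "\<And>x. u x \<le> 1"
    "u y = 1" "\<And>x. x \<notin> W \<Longrightarrow> u x = 0"
    "\<And>n x. 1 \<le> n \<Longrightarrow> n \<le> N \<Longrightarrow> x \<in> \<Delta> n \<Longrightarrow> u x = 0 \<or> u ((\<alpha> ^^ n) x) = 0"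
proof -
  have "\<exists>V. open V \<and> y \<in> V \<and> (\<forall>x\<in>V \<inter> \<Delta> n. (\<alpha> ^^ n) x \<notin> V)" if n: "1 \<le> n" "n \<le> N" for n
  proof (cases "y \<in> \<Delta> n")
    case False
    then show ?thesis
      using closed_iter_dom[of n] by (intro exI[of _ "- \<Delta> n"]) auto
  next
    case True
    then have "(\<alpha> ^^ n) y \<noteq> y" using y[OF n] by (simp add: periodic_points_def)
    then obtain v :: "'x \<Rightarrow> real" where v: "continuous_on UNIV v"
      "v y = 1" "\<And>x. x \<notin> - {(\<alpha> ^^ n) y} \<Longrightarrow> v x = 0"
      by (metis compact_t2_bump[OF compact_space, of "- {(\<alpha> ^^ n) y}" y] closed_singleton
          open_Compl ComplI singletonD)
    \<comment> \<open>This is v after n steps, extended by 0 off \<Delta> n. Obtaining it through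
      \<delta> gives continuity on the whole space, although \<alpha> is arbitrary outside
      D.\<close>
    define v' where "v' = (\<delta> ^^ n) (\<lambda>x. complex_of_real (v x))"
    have v': "continuous_on UNIV (\<lambda>x. cmod (v' x))"
      unfolding v'_def
      by (intro continuous_on_norm_cont_fun endo_power_cont cont_fun_of_real v)
    have "open ({x. 1/2 < v x} \<inter> {x. cmod (v' x) < 1/2})"
      by (intro open_Int open_Collect_less v v' continuous_on_const)
    moreover have "v' y = 0" using v(3) by (simp add: v'_def endo_power_apply)
    moreover have "cmod (v' x) = \<bar>v ((\<alpha> ^^ n) x)\<bar>" if "x \<in> \<Delta> n" for x
      using that by (simp add: v'_def endo_power_apply)
    ultimately show ?thesis using v(2)
      by (intro exI[of _ "{x. 1/2 < v x} \<inter> {x. cmod (v' x) < 1/2}"]) auto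
  qed
  then obtain V where V: "\<And>n. 1 \<le> n \<Longrightarrow> n \<le> N \<Longrightarrow> open (V n)" "\<And>n. 1 \<le> n \<Longrightarrow> n \<le> N \<Longrightarrow> y \<in> V n"
    "\<And>n x. 1 \<le> n \<Longrightarrow> n \<le> N \<Longrightarrow> x \<in> V n \<Longrightarrow> x \<in> \<Delta> n \<Longrightarrow> (\<alpha> ^^ n) x \<notin> V n"
    by (metis IntI)
  have op: "open (W \<inter> (\<Inter>n\<in>{1..N}. V n))" "y \<in> W \<inter> (\<Inter>n\<in>{1..N}. V n)"
    using V W by (auto intro!: open_INT)
  obtain u :: "'x \<Rightarrow> real" where u: "continuous_on UNIV u" "\<And>x. 0 \<le> u x" "\<And>x. u x \<le> 1"
    "u y = 1" "\<And>x. x \<notin> W \<inter> (\<Inter>n\<in>{1..N}. V n) \<Longrightarrow> u x = 0"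
    using compact_t2_bump[OF compact_space op] by metis
  show ?thesis
  proof (rule that[of u])
    show "u x = 0 \<or> u ((\<alpha> ^^ n) x) = 0" if "1 \<le> n" "n \<le> N" "x \<in> \<Delta> n" for n x
    proof -
      have "z \<in> V n" if "u z \<noteq> 0" for z
      proof -
        have "z \<in> (\<Inter>n\<in>{1..N}. V n)" using u(5)[of z] that by blast
        then show ?thesis using \<open>1 \<le> n\<close> \<open>n \<le> N\<close> by auto
      qed
      then show ?thesis using V(3)[OF that(1,2) _ that(3)] by blast
    qed
  qed (use u in auto)
qed

end

section \<open>Covariant representations\<close>

definition mono_val :: "(('x \<Rightarrow> complex) \<Rightarrow> 'h::chilbert_space bop) \<Rightarrow> 'h bop \<Rightarrow>
    nat \<times> ('x \<Rightarrow> complex) \<times> nat \<Rightarrow> 'h bop"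
  where "mono_val \<pi> U = (\<lambda>(k, a, l). adj U ^ k * \<pi> a * U ^ l)"

text \<open>Where the two monomials meet, \<open>U ^ i * adj U ^ i\<close> with i the minimum of l
  and m acts on the coefficients as the indicator of the domain of the i-th iterate. The leftover
  power of \<open>U\<close> or \<open>adj U\<close> is moved past a coefficient at the price of a
  power of \<open>endo\<close>. No representation enters, so one formal product serves for all of
  them.\<close>

definition mono_mult :: "'x set \<Rightarrow> ('x \<Rightarrow> 'x) \<Rightarrow> nat \<times> ('x \<Rightarrow> complex) \<times> nat \<Rightarrow>
    nat \<times> ('x \<Rightarrow> complex) \<times> nat \<Rightarrow> nat \<times> ('x \<Rightarrow> complex) \<times> nat"
  where "mono_mult D \<alpha> = (\<lambda>(k, a, l) (m, b, n).
    if l \<le> m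
    then (k + (m - l), \<lambda>x. (endo D \<alpha> ^^ (m - l)) (\<lambda>x. a x * chi (iter_dom D \<alpha> l) x) x * b x, n)
    else (k, \<lambda>x. a x * (endo D \<alpha> ^^ (l - m)) (\<lambda>x. chi (iter_dom D \<alpha> m) x * b x) x, (l - m) + n))"

definition mono_adj :: "nat \<times> ('x \<Rightarrow> complex) \<times> nat \<Rightarrow> nat \<times> ('x \<Rightarrow> complex) \<times> nat"
  where "mono_adj = (\<lambda>(k, a, l). (l, \<lambda>x. cnj (a x), k))"

text \<open>The coefficient \<open>c\<close> with
  \<open>U*\<^sup>k \<pi>(a) U\<^sup>k \<cdot> U*\<^sup>N \<pi>(h) U\<^sup>N = U*\<^sup>N \<pi>(c h) U\<^sup>N\<close>.\<close>

definition diag_coeff :: "'x set \<Rightarrow> ('x \<Rightarrow> 'x) \<Rightarrow> nat \<Rightarrow> nat \<times> ('x \<Rightarrow> complex) \<times> nat \<Rightarrow> 'x \<Rightarrow> complex"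
  where "diag_coeff D \<alpha> N = (\<lambda>(k, a, l) x. if k = l \<and> k \<le> N then (endo D \<alpha> ^^ (N - k)) a x else 0)"

locale cov_rep = partial_system D \<alpha>
  for D :: "'x::t2_space set" and \<alpha> :: "'x \<Rightarrow> 'x" +
  fixes \<pi> :: "('x \<Rightarrow> complex) \<Rightarrow> 'h::chilbert_space bop" and U :: "'h bop"
  assumes rep: "cov_faith_rep D \<alpha> \<pi> U"
begin

section \<open>Commutation relations between U and the functions\<close>

lemma covariant: "covariant_representation D \<alpha> \<pi> U"
  and pi_inj: "inj_on \<pi> cont_fun"
  using rep unfolding cov_faith_rep_def by blast+

lemma representation: "representation \<pi>"
  and partial_iso: "partial_isometry U"
  and initial_space: "initial_space U = {bop_apply (\<pi> a) h |a h. a \<in> cont_fun_on (\<alpha> ` D)}"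
  and covariance_all: "\<forall>a\<in>cont_fun. U * \<pi> a * adj U = \<pi> (\<delta> a)"
  using covariant unfolding covariant_representation_def by blast+

lemma pi_add: "a \<in> cont_fun \<Longrightarrow> b \<in> cont_fun \<Longrightarrow> \<pi> (\<lambda>x. a x + b x) = \<pi> a + \<pi> b"
  and pi_mult: "a \<in> cont_fun \<Longrightarrow> b \<in> cont_fun \<Longrightarrow> \<pi> (\<lambda>x. a x * b x) = \<pi> a * \<pi> b"
  and pi_scale: "a \<in> cont_fun \<Longrightarrow> \<pi> (\<lambda>x. c * a x) = c *\<^sub>C \<pi> a"
  and pi_cnj: "a \<in> cont_fun \<Longrightarrow> \<pi> (\<lambda>x. cnj (a x)) = adj (\<pi> a)"
  using representation unfolding representation_def by blast+

lemma covariance: "a \<in> cont_fun \<Longrightarrow> U * \<pi> a * adj U = \<pi> (\<delta> a)"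
  using covariance_all by blast

lemma pi_zero [simp]: "\<pi> (\<lambda>x. 0) = 0"
  using pi_add[of "\<lambda>x. 0" "\<lambda>x. 0"] by simp

lemma pi_diff: "a \<in> cont_fun \<Longrightarrow> b \<in> cont_fun \<Longrightarrow> \<pi> (\<lambda>x. a x - b x) = \<pi> a - \<pi> b"
  using pi_add[of "\<lambda>x. a x - b x" b] by (simp add: cont_fun_diff)

lemma chi_image_cont: "chi (\<alpha> ` D) \<in> cont_fun"
  by (rule cont_fun_chi[OF open_image closed_image])

lemma chi_self_mult: "chi S x * chi S x = chi S x"
  by (simp add: chi_def)

text \<open>The image p of the indicator function is the projection onto the initial space. U
  vanishes on the complement of its range and is isometric on the range, so
  \<open>adj U * U - p\<close> has zero quadratic form.\<close>

lemma adj_mult_self: "adj U * U = \<pi> (chi (\<alpha> ` D))"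
proof -
  define p where "p = \<pi> (chi (\<alpha> ` D))"
  have pp: "p * p = p"
    unfolding p_def by (simp add: chi_image_cont chi_self_mult flip: pi_mult)
  have p_adj: "adj p = p"
    unfolding p_def pi_cnj[OF chi_image_cont, symmetric] by (rule arg_cong[of _ _ \<pi>]) (auto simp: chi_def)
  have init: "initial_space U = range (bop_apply p)"
  proof -
    have "\<pi> a = p * \<pi> a" if "a \<in> cont_fun_on (\<alpha> ` D)" for a
    proof -
      have "a = (\<lambda>x. chi (\<alpha> ` D) x * a x)"
        using that by (auto simp: cont_fun_on_def chi_def)
      then show ?thesis
        using that pi_mult[OF chi_image_cont, of a] by (simp add: p_def cont_fun_on_def)
    qed
    moreover have "chi (\<alpha> ` D) \<in> cont_fun_on (\<alpha> ` D)"
      using chi_image_cont by (simp add: cont_fun_on_def chi_def)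
    ultimately have "{bop_apply (\<pi> a) h |a h. a \<in> cont_fun_on (\<alpha> ` D)} = range (bop_apply p)"
      unfolding p_def by (auto, metis bop_apply_simps(4) rangeI)
    then show ?thesis using initial_space by simp
  qed
  have ker: "bop_apply U (x - bop_apply p x) = 0" for x
  proof (rule cinner_ext)
    fix y
    \<comment> \<open>The range of \<open>adj U\<close> is orthogonal to the kernel of U, so it lies
      in the range of p, and \<open>x - bop_apply p x\<close> is orthogonal to it.\<close>
    have "bop_apply (adj U) y \<in> initial_space U"
      by (simp add: initial_space_def cinner_adj_left)
    then obtain w where w: "bop_apply (adj U) y = bop_apply p w" using init by auto
    have "cinner (x - bop_apply p x) (bop_apply p w) = cinner (bop_apply p (x - bop_apply p x)) w"
      by (metis cinner_adj_left p_adj)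
    also have "bop_apply p (x - bop_apply p x) = bop_apply (p - p * p) x" by simp
    finally have "cinner (x - bop_apply p x) (bop_apply (adj U) y) = 0"
      by (simp add: pp w)
    then show "cinner (bop_apply U (x - bop_apply p x)) y = cinner 0 y"
      by (simp only: cinner_adj_right cinner_zero_left)
  qed
  have Up: "U * p = U"
    using ker by (intro bop_ext) simp
  have "adj U * U - p = 0"
  proof (rule bop_zero_of_quadratic_form)
    fix x
    have "norm (bop_apply U (bop_apply p x)) = norm (bop_apply p x)"
      using partial_iso init unfolding partial_isometry_def by blast
    then have "cinner (bop_apply (U * p) x) (bop_apply (U * p) x) = cinner (bop_apply p x) (bop_apply p x)"
      by (simp add: cinner_self)
    then have "cinner (bop_apply U x) (bop_apply U x) = cinner x (bop_apply (adj p * p) x)"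
      by (simp only: Up) (simp add: cinner_adj_right)
    then show "cinner x (bop_apply (adj U * U - p) x) = 0"
      by (simp add: p_adj pp cinner_diff_right cinner_adj_right)
  qed
  then show ?thesis by (simp add: p_def)
qed

lemma mult_pi_chi: "U * \<pi> (chi (\<alpha> ` D)) = U"
proof -
  let ?p = "\<pi> (chi (\<alpha> ` D))"
  have pp: "?p * ?p = ?p"
    by (simp add: chi_image_cont chi_self_mult flip: pi_mult)
  have p_adj: "adj ?p = ?p"
    unfolding adj_mult_self[symmetric] by simp
  have "adj (U * ?p - U) * (U * ?p - U) = ?p * (adj U * U) * ?p - ?p * (adj U * U) - (adj U * U) * ?p + adj U * U"
    by (simp add: p_adj algebra_simps)
  also have "\<dots> = 0" by (simp add: adj_mult_self pp)
  finally have "norm (adj (U * ?p - U) * (U * ?p - U)) = 0" by simp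
  then show ?thesis unfolding norm_adj_mult by simp
qed

lemma pi_mult_commute: "a \<in> cont_fun \<Longrightarrow> b \<in> cont_fun \<Longrightarrow> \<pi> a * \<pi> b = \<pi> b * \<pi> a"
  by (simp add: mult.commute flip: pi_mult)

text \<open>Covariance has a factor \<open>adj U\<close> on the right. It is cancelled by a further
  U, because the initial projection \<open>adj U * U\<close> lies in the commutative range of \<pi>,
  hence commutes with \<open>\<pi> a\<close> and is absorbed by U.\<close>

lemma U_pi: assumes "a \<in> cont_fun" shows "U * \<pi> a = \<pi> (\<delta> a) * U"
proof -
  have "U * \<pi> a = U * (\<pi> (chi (\<alpha> ` D)) * \<pi> a)"
    by (simp add: mult_pi_chi flip: mult.assoc)
  also have "\<dots> = U * \<pi> a * adj U * U"
    unfolding pi_mult_commute[OF chi_image_cont assms] by (simp only: adj_mult_self mult.assoc)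
  finally show ?thesis by (simp only: covariance[OF assms])
qed

lemma U_power_pi: "a \<in> cont_fun \<Longrightarrow> U ^ n * \<pi> a = \<pi> ((\<delta> ^^ n) a) * U ^ n"
proof (induction n)
  case (Suc n)
  have "U ^ Suc n * \<pi> a = U * (U ^ n * \<pi> a)" by (simp add: mult.assoc)
  also have "\<dots> = U * \<pi> ((\<delta> ^^ n) a) * U ^ n" using Suc by (simp add: mult.assoc)
  also have "\<dots> = \<pi> ((\<delta> ^^ Suc n) a) * U ^ Suc n"
    using U_pi[OF endo_power_cont[OF Suc.prems]] by (simp add: mult.assoc)
  finally show ?case .
qed simp

text \<open>This is the adjoint of \<open>U_power_pi\<close> at the conjugate function, conjugation
  being compatible with \<delta>.\<close>

lemma pi_adj_power: assumes "a \<in> cont_fun" shows "\<pi> a * adj U ^ n = adj U ^ n * \<pi> ((\<delta> ^^ n) a)"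
proof -
  have eq: "(\<lambda>x. cnj ((\<delta> ^^ n) (\<lambda>x. cnj (a x)) x)) = (\<delta> ^^ n) a"
    by (rule ext) (simp add: endo_power_apply)
  have "\<pi> a * adj U ^ n = adj (U ^ n * \<pi> (\<lambda>x. cnj (a x)))"
    unfolding pi_cnj[OF assms] by simp
  also have "\<dots> = adj (\<pi> ((\<delta> ^^ n) (\<lambda>x. cnj (a x))) * U ^ n)"
    by (simp only: U_power_pi[OF cont_fun_cnj[OF assms]])
  also have "\<dots> = adj U ^ n * \<pi> ((\<delta> ^^ n) a)"
    unfolding adj_mult adj_power pi_cnj[OF endo_power_cont[OF cont_fun_cnj[OF assms]], symmetric] eq ..
  finally show ?thesis .
qed

lemma pi_one_mult: "a \<in> cont_fun \<Longrightarrow> \<pi> (\<lambda>x. 1) * \<pi> a = \<pi> a"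
  and pi_mult_one: "a \<in> cont_fun \<Longrightarrow> \<pi> a * \<pi> (\<lambda>x. 1) = \<pi> a"
  by (simp_all flip: pi_mult)

text \<open>As \<pi> 1 may be a proper projection, this and \<open>pi_one_U\<close> are what make it
  a unit for all monomials.\<close>

lemma U_pi_one: "U * \<pi> (\<lambda>x. 1) = U"
  by (metis mult.assoc mult_pi_chi pi_mult_one chi_image_cont)

lemma U_mult_adj: "U * adj U = \<pi> (chi D)"
proof -
  have "\<delta> (\<lambda>x. 1) = chi D" by (auto simp: endo_def chi_def)
  then show ?thesis using covariance[of "\<lambda>x. 1"] by (simp add: U_pi_one)
qed

lemma pi_mult_power_pi_one: "a \<in> cont_fun \<Longrightarrow> \<pi> a * U ^ n * \<pi> (\<lambda>x. 1) = \<pi> a * U ^ n"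
proof (cases n)
  case (Suc m)
  have "U ^ n * \<pi> (\<lambda>x. 1) = U ^ n"
    unfolding Suc power_Suc2 by (simp add: mult.assoc U_pi_one)
  then show ?thesis by (simp add: mult.assoc)
qed (simp add: pi_mult_one)

text \<open>The exponent is a successor because the zeroth power gives the identity operator, which
  can differ from \<pi> 1. The versions with a factor \<pi> a below hold for every exponent.\<close>

lemma power_mult_adj_power: "U ^ Suc n * adj U ^ Suc n = \<pi> (chi (\<Delta> (Suc n)))"
proof (induction n)
  case 0
  then show ?case by (simp add: U_mult_adj iter_dom_def)
next
  case (Suc n)
  have "U ^ Suc (Suc n) * adj U ^ Suc (Suc n) = U * (U ^ Suc n * adj U ^ Suc n) * adj U"
    unfolding power_Suc[of U "Suc n"] power_Suc2[of "adj U" "Suc n"] by (simp only: mult.assoc)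
  also have "\<dots> = \<pi> (\<delta> (chi (\<Delta> (Suc n))))"
    using Suc covariance[OF chi_iter_dom_cont] by simp
  also have "\<delta> (chi (\<Delta> (Suc n))) = chi (\<Delta> (Suc (Suc n)))"
    unfolding endo_power_one[symmetric] by simp
  finally show ?case .
qed

lemma pi_power_adj_power:
  "a \<in> cont_fun \<Longrightarrow> \<pi> a * U ^ n * adj U ^ n = \<pi> (\<lambda>x. a x * chi (\<Delta> n) x)"
proof (cases n)
  case 0
  then show ?thesis by (simp add: chi_def)
next
  case (Suc m)
  assume a: "a \<in> cont_fun"
  show ?thesis
    unfolding Suc mult.assoc power_mult_adj_power
    by (rule pi_mult[OF a chi_iter_dom_cont, symmetric])
qed

lemma power_adj_power_pi:
  "a \<in> cont_fun \<Longrightarrow> U ^ n * adj U ^ n * \<pi> a = \<pi> (\<lambda>x. chi (\<Delta> n) x * a x)"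
proof (cases n)
  case 0
  then show ?thesis by (simp add: chi_def)
next
  case (Suc m)
  assume a: "a \<in> cont_fun"
  show ?thesis
    unfolding Suc power_mult_adj_power
    by (rule pi_mult[OF chi_iter_dom_cont a, symmetric])
qed

section \<open>Multiplication and adjoints of monomials\<close>

abbreviation val where "val \<equiv> mono_val \<pi> U"

lemma val_mult:
  assumes a: "a \<in> cont_fun" and b: "b \<in> cont_fun"
  shows "val (k, a, l) * val (m, b, n) = val (mono_mult D \<alpha> (k, a, l) (m, b, n))"
proof (cases "l \<le> m")
  case True
  have c: "(\<lambda>x. a x * chi (\<Delta> l) x) \<in> cont_fun"
    by (rule cont_fun_mult[OF a chi_iter_dom_cont])
  have "adj U ^ m = adj U ^ l * adj U ^ (m - l)" using True by (simp flip: power_add)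
  then have "val (k, a, l) * val (m, b, n)
      = adj U ^ k * (\<pi> a * U ^ l * adj U ^ l) * adj U ^ (m - l) * \<pi> b * U ^ n"
    by (simp add: mono_val_def mult.assoc)
  also have "\<dots> = adj U ^ k * (\<pi> (\<lambda>x. a x * chi (\<Delta> l) x) * adj U ^ (m - l)) * \<pi> b * U ^ n"
    by (simp only: pi_power_adj_power[OF a, symmetric] mult.assoc)
  also have "\<dots> = adj U ^ (k + (m - l)) * (\<pi> ((\<delta> ^^ (m - l)) (\<lambda>x. a x * chi (\<Delta> l) x)) * \<pi> b) * U ^ n"
    by (simp only: pi_adj_power[OF c] mult.assoc power_add)
  finally show ?thesis
    using True by (simp add: mono_val_def mono_mult_def pi_mult[OF endo_power_cont[OF c] b])
next
  case False
  have c: "(\<lambda>x. chi (\<Delta> m) x * b x) \<in> cont_fun"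
    by (rule cont_fun_mult[OF chi_iter_dom_cont b])
  have "U ^ l = U ^ (l - m) * U ^ m" using False by (simp flip: power_add)
  then have "val (k, a, l) * val (m, b, n)
      = adj U ^ k * \<pi> a * U ^ (l - m) * (U ^ m * adj U ^ m * \<pi> b) * U ^ n"
    by (simp add: mono_val_def mult.assoc)
  also have "\<dots> = adj U ^ k * \<pi> a * (U ^ (l - m) * \<pi> (\<lambda>x. chi (\<Delta> m) x * b x)) * U ^ n"
    by (simp only: power_adj_power_pi[OF b, symmetric] mult.assoc)
  also have "\<dots> = adj U ^ k * (\<pi> a * \<pi> ((\<delta> ^^ (l - m)) (\<lambda>x. chi (\<Delta> m) x * b x))) * U ^ (l - m + n)"
    by (simp only: U_power_pi[OF c] mult.assoc power_add)
  finally show ?thesis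
    using False by (simp add: mono_val_def mono_mult_def pi_mult[OF a endo_power_cont[OF c]])
qed

lemma val_adj: "a \<in> cont_fun \<Longrightarrow> val (mono_adj (k, a, l)) = adj (val (k, a, l))"
  by (simp add: mono_val_def mono_adj_def pi_cnj mult.assoc)

lemma val_pi_one: "a \<in> cont_fun \<Longrightarrow> val (k, a, l) * \<pi> (\<lambda>x. 1) = val (k, a, l)"
  by (simp add: mono_val_def mult.assoc pi_mult_power_pi_one[unfolded mult.assoc])

section \<open>Faithful representations of C(X) are isometric\<close>

lemma norm_pi_le:
  assumes a: "a \<in> cont_fun" and s: "0 \<le> s" "\<And>x. cmod (a x) \<le> s"
  shows "norm (\<pi> a) \<le> s"
proof (rule norm_bop_leI[OF s(1)])
  fix h
  \<comment> \<open>The square root makes s^2 minus the squared modulus of a equal to the squared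
    modulus of g. The operator \<open>adj (\<pi> g) * \<pi> g\<close> is positive, which bounds
    \<pi> a.\<close>
  define g where "g x = complex_of_real (sqrt (s\<^sup>2 - (cmod (a x))\<^sup>2))" for x
  have g: "g \<in> cont_fun"
    unfolding g_def[abs_def]
    by (intro cont_fun_of_real continuous_intros continuous_on_norm_cont_fun a)
  have eq: "(\<lambda>x. cnj (g x) * g x) = (\<lambda>x. complex_of_real (s\<^sup>2) * 1 - cnj (a x) * a x)"
  proof
    fix x
    have "0 \<le> s\<^sup>2 - (cmod (a x))\<^sup>2" using power_mono[OF s(2)[of x], of 2] by simp
    then have "cnj (g x) * g x = complex_of_real (s\<^sup>2 - (cmod (a x))\<^sup>2)"
      by (simp add: g_def flip: of_real_mult)
    then show "cnj (g x) * g x = complex_of_real (s\<^sup>2) * 1 - cnj (a x) * a x"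
      by (simp only: of_real_diff complex_norm_square mult_1_right mult.commute[of "cnj (a x)"])
  qed
  have "adj (\<pi> g) * \<pi> g = \<pi> (\<lambda>x. cnj (g x) * g x)"
    unfolding pi_mult[OF cont_fun_cnj[OF g] g] pi_cnj[OF g] ..
  also have "\<dots> = \<pi> (\<lambda>x. complex_of_real (s\<^sup>2) * 1) - \<pi> (\<lambda>x. cnj (a x) * a x)"
    unfolding eq by (rule pi_diff[OF _ cont_fun_mult[OF cont_fun_cnj[OF a] a]]) simp
  finally have "adj (\<pi> g) * \<pi> g = complex_of_real (s\<^sup>2) *\<^sub>C \<pi> (\<lambda>x. 1) - adj (\<pi> a) * \<pi> a"
    unfolding pi_mult[OF cont_fun_cnj[OF a] a] pi_cnj[OF a] pi_scale[OF cont_fun_const] .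
  then have "cinner h (bop_apply (adj (\<pi> g) * \<pi> g) h)
      = complex_of_real (s\<^sup>2) * cinner h (bop_apply (\<pi> (\<lambda>x. 1)) h) - cinner h (bop_apply (adj (\<pi> a) * \<pi> a) h)"
    by (simp add: cinner_diff_right cinner_scaleC_right)
  then have "(norm (bop_apply (\<pi> g) h))\<^sup>2 = s\<^sup>2 * inner h (bop_apply (\<pi> (\<lambda>x. 1)) h) - (norm (bop_apply (\<pi> a) h))\<^sup>2"
    by (simp add: cinner_adj_right cinner_self inner_eq_Re_cinner complex_eq_iff)
  then have "(norm (bop_apply (\<pi> a) h))\<^sup>2 \<le> s\<^sup>2 * inner h (bop_apply (\<pi> (\<lambda>x. 1)) h)"
    by (smt (verit) zero_le_power2)
  also have "\<dots> \<le> s\<^sup>2 * (norm h)\<^sup>2"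
  proof (rule mult_left_mono)
    \<comment> \<open>\<open>?e\<close> is a self-adjoint idempotent, possibly not the identity, so
      its quadratic form is at most the squared norm.\<close>
    let ?e = "\<pi> (\<lambda>x. 1)"
    have "adj ?e = ?e" using pi_cnj[of "\<lambda>x. 1"] by simp
    then have "adj ?e * ?e = ?e" using pi_one_mult[of "\<lambda>x. 1"] by simp
    then have "cinner h (bop_apply ?e h) = cinner (bop_apply ?e h) (bop_apply ?e h)"
      by (metis bop_apply_simps(4) cinner_adj_right)
    then have *: "inner h (bop_apply ?e h) = norm (bop_apply ?e h) * norm (bop_apply ?e h)"
      by (simp add: inner_eq_Re_cinner cinner_self power2_eq_square)
    moreover have "inner h (bop_apply ?e h) \<le> norm h * norm (bop_apply ?e h)"
      by (rule norm_cauchy_schwarz)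
    ultimately have le: "norm (bop_apply ?e h) \<le> norm h"
      by (cases "norm (bop_apply ?e h) = 0") auto
    show "inner h (bop_apply ?e h) \<le> (norm h)\<^sup>2"
      unfolding * power2_eq_square by (intro mult_mono le) auto
  qed simp
  finally have "(norm (bop_apply (\<pi> a) h))\<^sup>2 \<le> (s * norm h)\<^sup>2" by (simp add: power_mult_distrib)
  then show "norm (bop_apply (\<pi> a) h) \<le> s * norm h"
    by (rule power2_le_imp_le) (simp add: s)
qed

text \<open>If \<open>norm (\<pi> a) < cmod (a y)\<close>, then with \<open>g = max 0 ((cmod a)\<^sup>2 - c\<^sup>2)\<close> for a constant
  \<open>c\<close> in between, \<open>\<pi> a\<close> expands the nonzero vectors in the range of \<open>\<pi> g\<close> by at least \<open>c\<close>.\<close>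

lemma norm_pi_ge:
  assumes a: "a \<in> cont_fun"
  shows "cmod (a y) \<le> norm (\<pi> a)"
proof (rule ccontr)
  assume "\<not> ?thesis"
  then obtain c where c: "norm (\<pi> a) < c" "c < cmod (a y)" using dense not_le by blast
  have "0 < c" using c(1) norm_ge_zero[of "\<pi> a"] by linarith
  define r where "r x = max 0 ((cmod (a x))\<^sup>2 - c\<^sup>2)" for x
  define g where "g x = complex_of_real (r x)" for x
  \<comment> \<open>The square of k is r^3. Where r is nonzero it equals the squared modulus of a
    minus c^2, so r^3 is that difference times g^2 everywhere. Thus the estimate for \<pi> a on the
    range of \<pi> g becomes the positivity of \<open>adj (\<pi> k) * \<pi> k\<close>.\<close>
  define k where "k x = complex_of_real (r x * sqrt (r x))" for x
  have r: "continuous_on UNIV r"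
    unfolding r_def[abs_def] by (intro continuous_intros continuous_on_norm_cont_fun a)
  have g: "g \<in> cont_fun" and k: "k \<in> cont_fun"
    unfolding g_def[abs_def] k_def[abs_def] by (intro cont_fun_of_real continuous_intros r)+
  have eq: "(\<lambda>x. cnj (k x) * k x) = (\<lambda>x. cnj (a x * g x) * (a x * g x) - complex_of_real (c\<^sup>2) * (cnj (g x) * g x))"
  proof
    fix x
    have "0 \<le> r x" by (simp add: r_def)
    have "r x * (r x * r x) = ((cmod (a x))\<^sup>2 - c\<^sup>2) * (r x * r x)" by (simp add: r_def max_def)
    then have rr: "r x * r x * r x = (cmod (a x))\<^sup>2 * (r x * r x) - c\<^sup>2 * (r x * r x)"
      by (simp only: left_diff_distrib mult.assoc)
    have "cnj (k x) * k x = complex_of_real (r x * r x * (sqrt (r x) * sqrt (r x)))"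
      by (simp add: k_def mult_ac flip: of_real_mult)
    also have "\<dots> = complex_of_real (r x * r x * r x)" using \<open>0 \<le> r x\<close> by simp
    also have "\<dots> = complex_of_real ((cmod (a x))\<^sup>2) * (g x * g x) - complex_of_real (c\<^sup>2) * (g x * g x)"
      unfolding rr by (simp add: g_def)
    also have "\<dots> = cnj (a x * g x) * (a x * g x) - complex_of_real (c\<^sup>2) * (cnj (g x) * g x)"
      unfolding complex_norm_square by (simp add: g_def mult_ac)
    finally show "cnj (k x) * k x = \<dots>" .
  qed
  have op: "adj (\<pi> k) * \<pi> k = adj (\<pi> a * \<pi> g) * (\<pi> a * \<pi> g) - complex_of_real (c\<^sup>2) *\<^sub>C (adj (\<pi> g) * \<pi> g)"
  proof -
    have ag: "(\<lambda>x. a x * g x) \<in> cont_fun" by (rule cont_fun_mult[OF a g])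
    have gg: "(\<lambda>x. cnj (g x) * g x) \<in> cont_fun" by (rule cont_fun_mult[OF cont_fun_cnj[OF g] g])
    have 1: "\<pi> (\<lambda>x. cnj (a x * g x) * (a x * g x)) = adj (\<pi> a * \<pi> g) * (\<pi> a * \<pi> g)"
      unfolding pi_mult[OF cont_fun_cnj[OF ag] ag] pi_cnj[OF ag] pi_mult[OF a g] ..
    have 2: "\<pi> (\<lambda>x. complex_of_real (c\<^sup>2) * (cnj (g x) * g x)) = complex_of_real (c\<^sup>2) *\<^sub>C (adj (\<pi> g) * \<pi> g)"
      unfolding pi_scale[OF gg] pi_mult[OF cont_fun_cnj[OF g] g] pi_cnj[OF g] ..
    have "adj (\<pi> k) * \<pi> k = \<pi> (\<lambda>x. cnj (k x) * k x)"
      unfolding pi_mult[OF cont_fun_cnj[OF k] k] pi_cnj[OF k] ..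
    also have "\<dots> = \<pi> (\<lambda>x. cnj (a x * g x) * (a x * g x)) - \<pi> (\<lambda>x. complex_of_real (c\<^sup>2) * (cnj (g x) * g x))"
      unfolding eq
      by (rule pi_diff[OF cont_fun_mult[OF cont_fun_cnj[OF ag] ag] cont_fun_mult[OF cont_fun_const gg]])
    finally show ?thesis unfolding 1 2 .
  qed
  have expand: "c * norm (bop_apply (\<pi> g) h) \<le> norm (bop_apply (\<pi> a) (bop_apply (\<pi> g) h))" for h
  proof -
    have "cinner h (bop_apply (adj (\<pi> k) * \<pi> k) h)
        = cinner h (bop_apply (adj (\<pi> a * \<pi> g) * (\<pi> a * \<pi> g)) h)
          - complex_of_real (c\<^sup>2) * cinner h (bop_apply (adj (\<pi> g) * \<pi> g) h)"
      unfolding op by (simp only: bop_apply_simps cinner_diff_right cinner_scaleC_right)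
    then have "complex_of_real ((norm (bop_apply (\<pi> k) h))\<^sup>2)
        = complex_of_real ((norm (bop_apply (\<pi> a) (bop_apply (\<pi> g) h)))\<^sup>2)
          - complex_of_real (c\<^sup>2) * complex_of_real ((norm (bop_apply (\<pi> g) h))\<^sup>2)"
      unfolding norm_eq_cinner bop_apply_simps(4)[of "adj _"] cinner_adj_right bop_apply_simps(4) .
    then have "(norm (bop_apply (\<pi> k) h))\<^sup>2
        = (norm (bop_apply (\<pi> a) (bop_apply (\<pi> g) h)))\<^sup>2 - c\<^sup>2 * (norm (bop_apply (\<pi> g) h))\<^sup>2"
      by (simp only: of_real_mult[symmetric] of_real_diff[symmetric] of_real_eq_iff)
    then have "(c * norm (bop_apply (\<pi> g) h))\<^sup>2 \<le> (norm (bop_apply (\<pi> a) (bop_apply (\<pi> g) h)))\<^sup>2"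
      unfolding power_mult_distrib by (smt (verit) zero_le_power2)
    then show ?thesis by (rule power2_le_imp_le) simp
  qed
  have "bop_apply (\<pi> g) h = 0" for h
  proof (rule ccontr)
    assume nz: "bop_apply (\<pi> g) h \<noteq> 0"
    have "c * norm (bop_apply (\<pi> g) h) \<le> norm (\<pi> a) * norm (bop_apply (\<pi> g) h)"
      using expand norm_bop_apply_le order_trans by blast
    then show False using nz c(1) by simp
  qed
  then have "\<pi> g = \<pi> (\<lambda>x. 0)" by (intro bop_ext) simp
  then have "g = (\<lambda>x. 0)" using pi_inj g by (simp add: inj_on_def)
  then have "g y = 0" by metis
  then have "r y = 0" by (simp only: g_def of_real_eq_0_iff)
  moreover have "c\<^sup>2 < (cmod (a y))\<^sup>2" using c(2) \<open>0 < c\<close> by (intro power_strict_mono) auto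
  ultimately show False by (simp add: r_def max_def split: if_splits)
qed

end

section \<open>Formal sums of monomials and their grading\<close>

definition cont_terms :: "(nat \<times> ('x::topological_space \<Rightarrow> complex) \<times> nat) list \<Rightarrow> bool"
  where "cont_terms xs \<longleftrightarrow> (\<forall>(k, a, l)\<in>set xs. a \<in> cont_fun)"

definition eval_terms :: "(('x \<Rightarrow> complex) \<Rightarrow> 'h::chilbert_space bop) \<Rightarrow> 'h bop \<Rightarrow>
    (nat \<times> ('x \<Rightarrow> complex) \<times> nat) list \<Rightarrow> 'h bop"
  where "eval_terms \<pi> U xs = (\<Sum>t\<leftarrow>xs. mono_val \<pi> U t)"

definition mult_terms where "mult_terms D \<alpha> xs ys = concat (map (\<lambda>s. map (mono_mult D \<alpha> s) ys) xs)"

definition mono_degree :: "nat \<times> ('x \<Rightarrow> complex) \<times> nat \<Rightarrow> int"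
  where "mono_degree = (\<lambda>(k, a, l). int l - int k)"

definition degree_part where "degree_part d xs = filter (\<lambda>t. mono_degree t = d) xs"

text \<open>This is the function c_N by which the degree 0 part acts at level N; triples of other
  degree contribute 0.\<close>

definition diag_sum_coeff :: "'x set \<Rightarrow> ('x \<Rightarrow> 'x) \<Rightarrow> nat \<Rightarrow> (nat \<times> ('x \<Rightarrow> complex) \<times> nat) list \<Rightarrow> 'x \<Rightarrow> complex"
  where "diag_sum_coeff D \<alpha> N xs = (\<lambda>x. \<Sum>t\<leftarrow>xs. diag_coeff D \<alpha> N t x)"

lemma cont_terms_simps [simp]:
  "cont_terms []"
  "cont_terms (t # xs) \<longleftrightarrow> fst (snd t) \<in> cont_fun \<and> cont_terms xs"
  "cont_terms (xs @ ys) \<longleftrightarrow> cont_terms xs \<and> cont_terms ys"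
  by (auto simp: cont_terms_def split_beta)

lemma eval_terms_simps [simp]:
  "eval_terms \<pi> U [] = 0"
  "eval_terms \<pi> U (t # xs) = mono_val \<pi> U t + eval_terms \<pi> U xs"
  "eval_terms \<pi> U (xs @ ys) = eval_terms \<pi> U xs + eval_terms \<pi> U ys"
  by (simp_all add: eval_terms_def)

lemma cont_terms_degree_part: "cont_terms xs \<Longrightarrow> cont_terms (degree_part d xs)"
  by (simp add: cont_terms_def degree_part_def)

lemma diag_coeff_other_degree: "mono_degree t \<noteq> 0 \<Longrightarrow> diag_coeff D \<alpha> N t = (\<lambda>x. 0)"
  by (cases t) (auto simp: diag_coeff_def mono_degree_def)

lemma diag_sum_coeff_degree_part:
  "diag_sum_coeff D \<alpha> N (degree_part 0 xs) = diag_sum_coeff D \<alpha> N xs"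
  by (induction xs) (auto simp: diag_sum_coeff_def degree_part_def diag_coeff_other_degree fun_eq_iff)

context partial_system
begin

lemma diag_coeff_cont: "fst (snd t) \<in> cont_fun \<Longrightarrow> diag_coeff D \<alpha> N t \<in> cont_fun"
proof -
  assume "fst (snd t) \<in> cont_fun"
  moreover obtain k a l where t: "t = (k, a, l)" by (cases t)
  moreover have "diag_coeff D \<alpha> N t = (if k = l \<and> k \<le> N then (\<delta> ^^ (N - k)) a else (\<lambda>x. 0))"
    by (auto simp: t diag_coeff_def)
  ultimately show ?thesis by (simp add: t endo_power_cont)
qed

lemma diag_sum_coeff_cont: "cont_terms xs \<Longrightarrow> diag_sum_coeff D \<alpha> N xs \<in> cont_fun"
  by (induction xs)
    (simp_all add: diag_sum_coeff_def cont_fun_add diag_coeff_cont[unfolded eta_contract_eq])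

text \<open>When M bounds all exponents k, raising the level by j merely applies \<delta> j more
  times. A value of c_M at the j-th image of y can thus be read off at y, which may be aperiodic
  even if the image is periodic.\<close>

lemma diag_sum_coeff_lift:
  assumes "\<And>k a l. (k, a, l) \<in> set xs \<Longrightarrow> k \<le> M" "y \<in> \<Delta> j" "(\<alpha> ^^ j) y \<in> \<Delta> M"
  shows "diag_sum_coeff D \<alpha> (M + j) xs y = diag_sum_coeff D \<alpha> M xs ((\<alpha> ^^ j) y)"
proof -
  have "diag_coeff D \<alpha> (M + j) t y = diag_coeff D \<alpha> M t ((\<alpha> ^^ j) y)" if "t \<in> set xs" for t
  proof -
    obtain k a l where t: "t = (k, a, l)" by (cases t)
    have k: "k \<le> M" using assms(1) that t by blast
    have eq: "M + j - k = j + (M - k)" using k by simp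
    have "(\<alpha> ^^ (j + (M - k))) y = (\<alpha> ^^ (M - k)) ((\<alpha> ^^ j) y)"
      by (subst add.commute) (simp only: funpow_add comp_apply)
    then show ?thesis
      using k assms(2,3) unfolding t diag_coeff_def prod.case eq endo_power_apply iter_dom_add
      by (auto intro: iter_dom_antimono)
  qed
  then show ?thesis
    unfolding diag_sum_coeff_def by (intro arg_cong[of _ _ sum_list] map_cong) auto
qed

end

lemma norm_bop_apply_le_of: "norm T \<le> s \<Longrightarrow> norm (bop_apply T x) \<le> s * norm x"
  by (rule order_trans[OF norm_bop_apply_le mult_right_mono]) simp_all

context cov_rep
begin

section \<open>The norm of a degree 0 element\<close>

lemma norm_pi_one_le: "norm (\<pi> (\<lambda>x. 1)) \<le> 1"
  by (rule norm_pi_le) simp_all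

lemma norm_U_le: "norm U \<le> 1"
proof -
  have "(norm U)\<^sup>2 = norm (\<pi> (chi (\<alpha> ` D)))" by (simp flip: norm_adj_mult add: adj_mult_self)
  also have "\<dots> \<le> 1" by (rule norm_pi_le[OF chi_image_cont]) (auto simp: chi_def)
  finally show ?thesis by (simp add: power_le_one_iff abs_square_le_1)
qed

lemma norm_mult_U_power_le: "norm (T * U ^ n) \<le> norm T"
proof (induction n)
  case (Suc n)
  have "norm (T * U ^ Suc n) = norm ((T * U ^ n) * U)"
    by (simp only: power_Suc2 mult.assoc)
  also have "\<dots> \<le> norm (T * U ^ n) * norm U" by (rule norm_mult_ineq)
  also have "\<dots> \<le> norm (T * U ^ n) * 1" by (intro mult_left_mono norm_U_le norm_ge_zero)
  finally show ?case using Suc by simp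
qed simp

lemma norm_adj_U_power_mult_le: "norm (adj U ^ n * T) \<le> norm T"
  using norm_mult_U_power_le[of "adj T" n] norm_adj[of "adj U ^ n * T"] by simp

lemma norm_val_le: "norm (val (k, a, l)) \<le> norm (\<pi> a)"
  unfolding mono_val_def
  by (simp add: mult.assoc) (rule order_trans[OF norm_adj_U_power_mult_le norm_mult_U_power_le])

text \<open>Moving \<pi> 1 from the right of \<open>U ^ N\<close> to its left turns it into the
  image of the indicator of \<Delta> N, which cuts away the values of the coefficient
  elsewhere.\<close>

lemma val_diag_cong:
  assumes "f \<in> cont_fun" "g \<in> cont_fun" "\<And>x. x \<in> \<Delta> N \<Longrightarrow> f x = g x"
  shows "val (k, f, N) = val (k, g, N)"
proof -
  have *: "\<pi> h * U ^ N = \<pi> (\<lambda>x. h x * chi (\<Delta> N) x) * U ^ N" if "h \<in> cont_fun" for h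
  proof -
    have "\<pi> h * U ^ N = \<pi> h * (U ^ N * \<pi> (\<lambda>x. 1))"
      using pi_mult_power_pi_one[OF that] by (simp add: mult.assoc)
    also have "\<dots> = \<pi> h * \<pi> (chi (\<Delta> N)) * U ^ N"
      by (simp only: U_power_pi[OF cont_fun_const] endo_power_one mult.assoc)
    finally show ?thesis by (simp add: pi_mult that chi_iter_dom_cont)
  qed
  have "(\<lambda>x. f x * chi (\<Delta> N) x) = (\<lambda>x. g x * chi (\<Delta> N) x)"
    using assms(3) by (auto simp: chi_def)
  then show ?thesis
    using *[OF assms(1)] *[OF assms(2)] by (simp add: mono_val_def mult.assoc)
qed

lemma norm_val_diag_le:
  assumes "f \<in> cont_fun" "0 \<le> s" "\<And>x. x \<in> \<Delta> N \<Longrightarrow> cmod (f x) \<le> s"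
  shows "norm (val (N, f, N)) \<le> s"
proof -
  have c: "(\<lambda>x. f x * chi (\<Delta> N) x) \<in> cont_fun"
    by (rule cont_fun_mult[OF assms(1) chi_iter_dom_cont])
  have "val (N, f, N) = val (N, \<lambda>x. f x * chi (\<Delta> N) x, N)"
    by (rule val_diag_cong[OF assms(1) c]) (simp add: chi_def)
  also have "norm \<dots> \<le> norm (\<pi> (\<lambda>x. f x * chi (\<Delta> N) x))" by (rule norm_val_le)
  also have "\<dots> \<le> s"
    by (rule norm_pi_le[OF c assms(2)]) (use assms in \<open>simp add: chi_def\<close>)
  finally show ?thesis .
qed

text \<open>Multiplying by \<open>U ^ N\<close> on the left and \<open>adj U ^ N\<close> on the
  right recovers \<pi> of the coefficient restricted to \<Delta> N. These factors are contractions,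
  and \<pi> is isometric by faithfulness.\<close>

lemma norm_val_diag_ge:
  assumes "f \<in> cont_fun" "y \<in> \<Delta> N"
  shows "cmod (f y) \<le> norm (val (N, f, N))"
proof -
  define g where "g x = chi (\<Delta> N) x * f x * chi (\<Delta> N) x" for x
  have g: "g \<in> cont_fun" unfolding g_def[abs_def]
    by (intro cont_fun_mult chi_iter_dom_cont assms)
  have "\<pi> g = \<pi> (chi (\<Delta> N)) * \<pi> f * \<pi> (chi (\<Delta> N))"
    unfolding g_def[abs_def]
    by (simp add: pi_mult cont_fun_mult chi_iter_dom_cont assms)
  also have "\<dots> = (\<pi> (\<lambda>x. 1) * U ^ N * adj U ^ N) * \<pi> f * (U ^ N * adj U ^ N * \<pi> (\<lambda>x. 1))"
    by (simp add: pi_power_adj_power power_adj_power_pi chi_def[abs_def])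
  also have "\<dots> = (\<pi> (\<lambda>x. 1) * U ^ N) * val (N, f, N) * (adj U ^ N * \<pi> (\<lambda>x. 1))"
    by (simp add: mono_val_def mult.assoc)
  also have "norm \<dots> \<le> norm (\<pi> (\<lambda>x. 1) * U ^ N) * norm (val (N, f, N)) * norm (adj U ^ N * \<pi> (\<lambda>x. 1))"
    by (rule order_trans[OF norm_mult_ineq mult_right_mono[OF norm_mult_ineq norm_ge_zero]])
  also have "\<dots> \<le> 1 * norm (val (N, f, N)) * 1"
    by (intro mult_mono order_trans[OF norm_mult_U_power_le norm_pi_one_le]
        order_trans[OF norm_adj_U_power_mult_le norm_pi_one_le]) auto
  finally have "norm (\<pi> g) \<le> norm (val (N, f, N))" by simp
  moreover have "g y = f y" using assms(2) by (simp add: g_def chi_def)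
  ultimately show ?thesis using norm_pi_ge[OF g, of y] by simp
qed

text \<open>Both orders give a monomial with the larger of the two exponents, and the coefficients
  multiply in the commutative algebra C(X).\<close>

lemma val_diag_commute:
  assumes "a \<in> cont_fun" "h \<in> cont_fun"
  shows "val (k, a, k) * val (N, h, N) = val (N, h, N) * val (k, a, k)"
proof -
  have *: "val (k, a, k) * val (N, h, N) = val (N, h, N) * val (k, a, k)"
    if "k \<le> N" "a \<in> cont_fun" "h \<in> cont_fun" for k N a h
    using that by (cases "k = N") (simp_all add: val_mult mono_mult_def mult_ac)
  show ?thesis using *[of k N a h] *[of N k h a] assms by (cases "k \<le> N") auto
qed

text \<open>For k > N the product contains h after k - N > 0 further steps of \<alpha>. These end in
  the image of \<alpha>, where h is assumed to vanish, so the default value 0 of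
  \<open>diag_coeff\<close> is then the correct coefficient.\<close>

lemma val_diag_absorb:
  assumes a: "a \<in> cont_fun" and h: "h \<in> cont_fun"
    and "k \<le> N \<or> (\<forall>x\<in>\<alpha> ` D. h x = 0)"
  shows "val (k, a, k) * val (N, h, N) = val (N, \<lambda>x. diag_coeff D \<alpha> N (k, a, k) x * h x, N)"
proof (cases "k \<le> N")
  case True
  have c: "(\<lambda>x. (\<delta> ^^ (N - k)) (\<lambda>x. a x * chi (\<Delta> k) x) x * h x) \<in> cont_fun"
    by (intro cont_fun_mult endo_power_cont a h chi_iter_dom_cont)
  have "val (k, a, k) * val (N, h, N) = val (N, \<lambda>x. (\<delta> ^^ (N - k)) (\<lambda>x. a x * chi (\<Delta> k) x) x * h x, N)"
    using True by (simp add: val_mult[OF a h] mono_mult_def)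
  also have "\<dots> = val (N, \<lambda>x. diag_coeff D \<alpha> N (k, a, k) x * h x, N)"
  proof (rule val_diag_cong[OF c])
    show "(\<lambda>x. diag_coeff D \<alpha> N (k, a, k) x * h x) \<in> cont_fun"
      by (intro cont_fun_mult h diag_coeff_cont) (simp add: a)
    fix x assume "x \<in> \<Delta> N"
    then have "x \<in> \<Delta> (N - k)" "(\<alpha> ^^ (N - k)) x \<in> \<Delta> k"
      using True iter_dom_add[of x D \<alpha> "N - k" k] by auto
    then show "(\<delta> ^^ (N - k)) (\<lambda>x. a x * chi (\<Delta> k) x) x * h x = diag_coeff D \<alpha> N (k, a, k) x * h x"
      using True by (simp add: endo_power_apply diag_coeff_def chi_def)
  qed
  finally show ?thesis .
next
  case False
  then obtain j where j: "k - N = Suc j" by (metis Suc_diff_Suc not_le)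
  have "(\<delta> ^^ (k - N)) (\<lambda>x. chi (\<Delta> N) x * h x) = (\<lambda>x. 0)"
  proof
    fix x
    have "h ((\<alpha> ^^ Suc j) x) = 0" if "x \<in> \<Delta> (Suc j)"
      using that assms(3) False by (simp add: iter_dom_def)
    then show "(\<delta> ^^ (k - N)) (\<lambda>x. chi (\<Delta> N) x * h x) x = 0"
      unfolding j endo_power_apply by simp
  qed
  then have "val (k, a, k) * val (N, h, N) = val (k, \<lambda>x. 0, k)"
    using False by (simp add: val_mult[OF a h] mono_mult_def)
  then show ?thesis
    using False by (simp add: mono_val_def diag_coeff_def)
qed

lemma val_diag_mult:
  assumes "f \<in> cont_fun" "g \<in> cont_fun"
  shows "val (N, f, N) * val (N, g, N) = val (N, \<lambda>x. f x * g x, N)"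
  using val_diag_absorb[OF assms, of N N] by (simp add: diag_coeff_def)

lemma val_diag_adj_real:
  assumes "f \<in> cont_fun" "\<And>x. cnj (f x) = f x"
  shows "adj (val (N, f, N)) = val (N, f, N)"
  using val_adj[OF assms(1), of N N] by (simp add: mono_adj_def assms(2))

lemma eval_diag_absorb:
  assumes "cont_terms xs" "h \<in> cont_fun" "\<And>t. t \<in> set xs \<Longrightarrow> mono_degree t = 0"
    "(\<forall>(k, a, l)\<in>set xs. k \<le> N) \<or> (\<forall>x\<in>\<alpha> ` D. h x = 0)"
  shows "eval_terms \<pi> U xs * val (N, h, N) = val (N, \<lambda>x. diag_sum_coeff D \<alpha> N xs x * h x, N)"
  using assms
proof (induction xs)
  case Nil
  then show ?case by (simp add: diag_sum_coeff_def mono_val_def)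
next
  case (Cons t xs)
  obtain k a l where t: "t = (k, a, l)" by (cases t)
  have l: "l = k" using Cons.prems(3)[of t] by (simp add: t mono_degree_def)
  have a: "a \<in> cont_fun" using Cons.prems(1) t by simp
  have "eval_terms \<pi> U (t # xs) * val (N, h, N)
      = val (N, \<lambda>x. diag_coeff D \<alpha> N t x * h x, N) + val (N, \<lambda>x. diag_sum_coeff D \<alpha> N xs x * h x, N)"
    using Cons val_diag_absorb[OF a Cons.prems(2), of k N]
    by (auto simp: distrib_right t l)
  also have "\<dots> = val (N, \<lambda>x. diag_coeff D \<alpha> N t x * h x + diag_sum_coeff D \<alpha> N xs x * h x, N)"
    using Cons.prems
    by (simp add: mono_val_def pi_add cont_fun_mult diag_coeff_cont diag_sum_coeff_cont algebra_simps)
  finally show ?case by (simp add: diag_sum_coeff_def distrib_right)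
qed

lemma eval_diag_commute:
  assumes "cont_terms xs" "h \<in> cont_fun" "\<And>t. t \<in> set xs \<Longrightarrow> mono_degree t = 0"
  shows "eval_terms \<pi> U xs * val (N, h, N) = val (N, h, N) * eval_terms \<pi> U xs"
  using assms
proof (induction xs)
  case (Cons t xs)
  obtain k a l where t: "t = (k, a, l)" by (cases t)
  have l: "l = k" using Cons.prems(3)[of t] by (simp add: t mono_degree_def)
  show ?case
    using Cons val_diag_commute[of a h k N] by (simp add: distrib_left distrib_right t l)
qed simp

lemma eval_mult_pi_one: "cont_terms xs \<Longrightarrow> eval_terms \<pi> U xs * \<pi> (\<lambda>x. 1) = eval_terms \<pi> U xs"
proof (induction xs)
  case (Cons t xs)
  then show ?case by (cases t) (simp add: distrib_right val_pi_one)
qed simp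

text \<open>Commuting U with 1 shows that U absorbs \<pi> (\<delta> 1) on the left, and \<pi> 1 is a
  left unit for that element.\<close>

lemma pi_one_U: "\<pi> (\<lambda>x. 1) * U = U"
proof -
  have d: "\<delta> (\<lambda>x. 1) \<in> cont_fun" by (simp add: endo_cont)
  have "U = \<pi> (\<delta> (\<lambda>x. 1)) * U" using U_pi[of "\<lambda>x. 1"] by (simp add: U_pi_one)
  then have "\<pi> (\<lambda>x. 1) * U = (\<pi> (\<lambda>x. 1) * \<pi> (\<delta> (\<lambda>x. 1))) * U" by (metis mult.assoc)
  also have "\<dots> = U" using U_pi[of "\<lambda>x. 1"] by (simp add: pi_one_mult[OF d] U_pi_one)
  finally show ?thesis .
qed

text \<open>The projections \<open>U*\<^sup>j (1 - U* U) U\<^sup>j\<close> for \<open>j < M\<close> and \<open>U*\<^sup>M U\<^sup>M\<close> are orthogonal, commute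
  with the diagonal terms and add up to \<open>\<pi> 1\<close>.\<close>

lemma norm_eval_diag_le:
  assumes xs: "cont_terms xs" "\<And>t. t \<in> set xs \<Longrightarrow> mono_degree t = 0" "\<forall>(k, a, l)\<in>set xs. k \<le> M"
    and s: "0 \<le> s" "\<And>N x. N < M \<Longrightarrow> x \<in> \<Delta> N \<Longrightarrow> x \<notin> \<alpha> ` D \<Longrightarrow> cmod (diag_sum_coeff D \<alpha> N xs x) \<le> s"
      "\<And>x. x \<in> \<Delta> M \<Longrightarrow> cmod (diag_sum_coeff D \<alpha> M xs x) \<le> s"
  shows "norm (eval_terms \<pi> U xs) \<le> s"
proof -
  define P where "P j = val (j, \<lambda>x. 1, j)" for j
  define r where "r x = 1 - chi (\<alpha> ` D) x" for x
  have r: "r \<in> cont_fun" unfolding r_def[abs_def] by (intro cont_fun_diff chi_image_cont) simp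
  define R where "R j = val (j, r, j)" for j
  let ?b = "eval_terms \<pi> U xs"
  have PP: "P j * P j = P j" for j
    using val_diag_mult[of "\<lambda>x. 1" "\<lambda>x. 1" j] by (simp add: P_def)
  have RR: "R j * R j = R j" for j
  proof -
    have "(\<lambda>x. r x * r x) = r" by (auto simp: r_def chi_def)
    then show ?thesis using val_diag_mult[OF r r, of j] by (simp add: R_def)
  qed
  have P_adj: "adj (P j) = P j" for j
    unfolding P_def by (rule val_diag_adj_real) simp_all
  have PSuc: "P (Suc j) * P j = P (Suc j)" for j
  proof -
    have "P (Suc j) * P j = val (Suc j, \<lambda>x. 1 * \<delta> (\<lambda>x. chi (\<Delta> j) x * 1) x, Suc j)"
      by (simp add: P_def val_mult mono_mult_def Suc_diff_le)
    also have "\<dots> = P (Suc j)" unfolding P_def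
    proof (rule val_diag_cong)
      show "(\<lambda>x. 1 * \<delta> (\<lambda>x. chi (\<Delta> j) x * 1) x) \<in> cont_fun"
        by (simp add: endo_cont chi_iter_dom_cont)
      fix x assume "x \<in> \<Delta> (Suc j)"
      then have "x \<in> D" "\<alpha> x \<in> \<Delta> j"
        using iter_dom_add[of x D \<alpha> 1 j] by (simp_all add: iter_dom_def)
      then show "1 * \<delta> (\<lambda>x. chi (\<Delta> j) x * 1) x = 1" by (simp add: endo_def chi_def)
    qed simp
    finally show ?thesis .
  qed
  have R_eq: "R j = P j - P (Suc j)" for j
  proof -
    have "P (Suc j) = adj U ^ j * (adj U * (\<pi> (\<lambda>x. 1) * U)) * U ^ j"
      unfolding P_def mono_val_def prod.case power_Suc2[of "adj U"] power_Suc[of U]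
      by (simp only: mult.assoc)
    also have "\<pi> (\<lambda>x. 1) * U = U" by (rule pi_one_U)
    finally have "P (Suc j) = adj U ^ j * \<pi> (chi (\<alpha> ` D)) * U ^ j"
      by (simp only: adj_mult_self)
    moreover have "\<pi> r = \<pi> (\<lambda>x. 1) - \<pi> (chi (\<alpha> ` D))"
      unfolding r_def[abs_def] by (rule pi_diff[OF cont_fun_const chi_image_cont])
    ultimately show ?thesis
      by (simp add: P_def R_def mono_val_def left_diff_distrib right_diff_distrib)
  qed
  have PR: "P (Suc j) * R j = 0" for j
    by (simp add: R_eq right_diff_distrib PSuc PP)
  have pyth: "(norm (x + y))\<^sup>2 = (norm x)\<^sup>2 + (norm y)\<^sup>2"
    if "cinner x y = 0" for x y :: 'h
  proof -
    have "inner x y = 0" using that by (simp add: inner_eq_Re_cinner)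
    then show ?thesis
      by (simp add: power2_norm_eq_inner inner_add_left inner_add_right inner_commute)
  qed
  have orth: "cinner (bop_apply (P (Suc j)) x) (bop_apply (R j) y) = 0" for j x y
  proof -
    have "cinner (bop_apply (P (Suc j)) x) (bop_apply (R j) y) = cinner x (bop_apply (P (Suc j) * R j) y)"
      by (metis P_adj cinner_adj_left bop_apply_simps(4))
    then show ?thesis by (simp add: PR)
  qed
  have step: "norm (bop_apply ?b (bop_apply (R j) x)) \<le> s * norm (bop_apply (R j) x)" if "j < M" for j x
  proof -
    \<comment> \<open>Since \<open>r\<close> vanishes on the image of \<alpha>, the absorption rule
      covers exponents above j as well, and c_j has to be bounded off the image only.\<close>
    have "?b * R j = val (j, \<lambda>x. diag_sum_coeff D \<alpha> j xs x * r x, j)"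
      unfolding R_def
      by (rule eval_diag_absorb[OF xs(1) r xs(2)]) (auto simp: r_def chi_def)
    moreover have "cmod (diag_sum_coeff D \<alpha> j xs x * r x) \<le> s" if "x \<in> \<Delta> j" for x
      using s(1) s(2)[OF \<open>j < M\<close> that] by (simp add: r_def chi_def)
    then have "norm (val (j, \<lambda>x. diag_sum_coeff D \<alpha> j xs x * r x, j)) \<le> s"
      by (rule norm_val_diag_le[OF cont_fun_mult[OF diag_sum_coeff_cont[OF xs(1)] r] s(1)])
    ultimately have "norm (?b * R j) \<le> s" by simp
    then have "norm (bop_apply (?b * R j) (bop_apply (R j) x)) \<le> s * norm (bop_apply (R j) x)"
      by (rule norm_bop_apply_le_of)
    also have "bop_apply (?b * R j) (bop_apply (R j) x) = bop_apply (?b * (R j * R j)) x" by simp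
    finally show ?thesis by (simp add: RR)
  qed
  \<comment> \<open>Downward induction from M. The projection P j splits into P (Suc j) and R j, and
    b commutes with both, so the two images under b stay orthogonal. By Pythagoras the constant s is
    kept at each step, where the triangle inequality would accumulate a factor.\<close>
  have main: "norm (bop_apply ?b (bop_apply (P j) x)) \<le> s * norm (bop_apply (P j) x)" if "j \<le> M" for j x
    using that
  proof (induction rule: inc_induct)
    case base
    have "?b * P M = val (M, \<lambda>x. diag_sum_coeff D \<alpha> M xs x * 1, M)"
      unfolding P_def
      by (rule eval_diag_absorb[OF xs(1) _ xs(2)]) (use xs(3) in simp_all)
    then have "norm (?b * P M) \<le> s"
      using s by (auto intro!: norm_val_diag_le diag_sum_coeff_cont xs)
    then have "norm (bop_apply (?b * P M) (bop_apply (P M) x)) \<le> s * norm (bop_apply (P M) x)"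
      by (rule norm_bop_apply_le_of)
    also have "bop_apply (?b * P M) (bop_apply (P M) x) = bop_apply (?b * (P M * P M)) x" by simp
    finally show ?case by (simp add: PP)
  next
    case (step j)
    let ?u = "bop_apply (P (Suc j)) x" and ?v = "bop_apply (R j) x"
    have dec: "bop_apply (P j) x = ?u + ?v" by (simp add: R_eq)
    have comm: "?b * P (Suc j) = P (Suc j) * ?b" "?b * R j = R j * ?b"
      unfolding P_def R_def by (rule eval_diag_commute[OF xs(1) _ xs(2)]; simp add: r)+
    have "cinner (bop_apply ?b ?u) (bop_apply ?b ?v) = 0"
      using orth[of j "bop_apply ?b x" "bop_apply ?b x"]
      by (simp only: bop_apply_simps(4)[symmetric] comm)
    then have "(norm (bop_apply ?b (bop_apply (P j) x)))\<^sup>2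
        = (norm (bop_apply ?b ?u))\<^sup>2 + (norm (bop_apply ?b ?v))\<^sup>2"
      by (simp add: dec pyth)
    also have "\<dots> \<le> (s * norm ?u)\<^sup>2 + (s * norm ?v)\<^sup>2"
      by (intro add_mono power_mono step.IH \<open>j < M\<close> norm_ge_zero
          \<open>\<And>j x. j < M \<Longrightarrow> norm (bop_apply ?b (bop_apply (R j) x)) \<le> s * norm (bop_apply (R j) x)\<close>)
    also have "\<dots> = s\<^sup>2 * (norm (?u + ?v))\<^sup>2"
      by (simp add: pyth[OF orth] power_mult_distrib distrib_left)
    also have "\<dots> = (s * norm (bop_apply (P j) x))\<^sup>2" by (simp only: dec power_mult_distrib)
    finally show ?case by (rule power2_le_imp_le) (simp add: s)
  qed
  show ?thesis
  proof (rule norm_bop_leI[OF s(1)])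
    fix x
    have P0: "P 0 = \<pi> (\<lambda>x. 1)" by (simp add: P_def mono_val_def)
    have "norm (bop_apply ?b x) = norm (bop_apply (?b * P 0) x)"
      unfolding P0 by (simp only: eval_mult_pi_one[OF xs(1)])
    also have "\<dots> \<le> s * norm (bop_apply (P 0) x)" using main[of 0 x] by simp
    also have "\<dots> \<le> s * (1 * norm x)"
      unfolding P0
      by (intro mult_left_mono s order_trans[OF norm_bop_apply_le] mult_right_mono norm_pi_one_le norm_ge_zero)
    finally show "norm (bop_apply ?b x) \<le> s * norm x" by simp
  qed
qed

section \<open>Compression by bump functions\<close>

lemma bump_compress_power:
  assumes f: "f \<in> cont_fun" "\<And>x. x \<notin> \<Delta> K \<Longrightarrow> f x = 0"
    and van: "\<And>x. x \<in> \<Delta> n \<Longrightarrow> f x * f ((\<alpha> ^^ n) x) = 0"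
  shows "val (K, f, K) * U ^ n * val (K, f, K) = 0"
proof -
  have UU: "U ^ K * U ^ n = U ^ n * U ^ K" by (simp add: add.commute flip: power_add)
  have chi_f: "(\<lambda>x. chi (\<Delta> K) x * f x) = f" using f(2) by (auto simp: chi_def)
  have "val (K, f, K) * U ^ n * val (K, f, K)
      = adj U ^ K * \<pi> f * (U ^ K * U ^ n) * adj U ^ K * \<pi> f * U ^ K"
    by (simp only: mono_val_def prod.case mult.assoc)
  \<comment> \<open>After the powers of U are interchanged, \<open>U ^ K * adj U ^ K\<close> meets
    the second f, which is supported in \<Delta> K and therefore unchanged by it.\<close>
  also have "\<dots> = adj U ^ K * \<pi> f * U ^ n * (U ^ K * adj U ^ K * \<pi> f) * U ^ K"
    by (simp only: UU mult.assoc)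
  also have "\<dots> = adj U ^ K * \<pi> f * U ^ n * \<pi> f * U ^ K"
    unfolding power_adj_power_pi[OF f(1)] chi_f ..
  also have "\<dots> = adj U ^ K * \<pi> f * (U ^ n * \<pi> f) * U ^ K"
    by (simp only: mult.assoc)
  also have "\<dots> = adj U ^ K * (\<pi> f * \<pi> ((\<delta> ^^ n) f)) * (U ^ n * U ^ K)"
    by (simp only: U_power_pi[OF f(1)] mult.assoc)
  also have "\<pi> f * \<pi> ((\<delta> ^^ n) f) = \<pi> (\<lambda>x. f x * (\<delta> ^^ n) f x)"
    by (rule pi_mult[OF f(1) endo_power_cont[OF f(1)], symmetric])
  also have "(\<lambda>x. f x * (\<delta> ^^ n) f x) = (\<lambda>x. 0)"
    using van by (auto simp: endo_power_apply)
  finally show ?thesis by simp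
qed

text \<open>A monomial of positive degree is one of degree 0 times a power of U; the former commutes
  with the compressing element, and the latter is annihilated by the compression. Negative degrees
  follow by taking adjoints, f being real.\<close>

lemma bump_compress_mono:
  assumes f: "f \<in> cont_fun" "\<And>x. x \<notin> \<Delta> K \<Longrightarrow> f x = 0" "\<And>x. cnj (f x) = f x"
    and van: "\<And>n x. 1 \<le> n \<Longrightarrow> n \<le> N \<Longrightarrow> x \<in> \<Delta> n \<Longrightarrow> f x * f ((\<alpha> ^^ n) x) = 0"
    and a: "a \<in> cont_fun" and kl: "k \<noteq> l" "\<bar>mono_degree (k, a, l)\<bar> \<le> int N"
  shows "val (K, f, K) * val (k, a, l) * val (K, f, K) = 0"
proof -
  have *: "val (K, f, K) * val (k, a, l) * val (K, f, K) = 0"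
    if "k < l" "\<bar>mono_degree (k, a, l)\<bar> \<le> int N" "a \<in> cont_fun" for k l a
  proof -
    have "1 \<le> l - k" "l - k \<le> N" using that by (simp_all add: mono_degree_def)
    then have z: "val (K, f, K) * U ^ (l - k) * val (K, f, K) = 0"
      by (intro bump_compress_power f van)
    have "U ^ l = U ^ k * U ^ (l - k)" using that(1) by (simp flip: power_add)
    then have "val (k, a, l) = val (k, a, k) * U ^ (l - k)"
      by (simp add: mono_val_def mult.assoc)
    then have "val (K, f, K) * val (k, a, l) * val (K, f, K)
        = (val (K, f, K) * val (k, a, k)) * U ^ (l - k) * val (K, f, K)"
      by (simp only: mult.assoc)
    also have "\<dots> = val (k, a, k) * (val (K, f, K) * U ^ (l - k) * val (K, f, K))"
      by (simp only: val_diag_commute[OF f(1) that(3)] mult.assoc)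
    finally show ?thesis by (simp add: z)
  qed
  show ?thesis
  proof (cases "k < l")
    case False
    have "val (K, f, K) * val (l, \<lambda>x. cnj (a x), k) * val (K, f, K) = 0"
      by (rule *) (use False kl a in \<open>auto simp: mono_degree_def cont_fun_cnj\<close>)
    then have "adj (val (K, f, K) * val (l, \<lambda>x. cnj (a x), k) * val (K, f, K)) = 0" by simp
    moreover have "val (l, \<lambda>x. cnj (a x), k) = adj (val (k, a, l))"
      using val_adj[OF a] by (simp add: mono_adj_def)
    ultimately show ?thesis
      by (simp add: val_diag_adj_real[OF f(1,3)] mult.assoc)
  qed (use * kl a in blast)
qed

text \<open>Compression leaves a single monomial at level K with coefficient c_K times f^2. As f is
  1 at y, its norm is at least the modulus of c_K(y), while the compressing element is a
  contraction. The alternatives in \<open>cover\<close> are those under which c_K is the true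
  coefficient.\<close>

lemma coeff_le_norm_eval:
  fixes u :: "'x \<Rightarrow> real"
  assumes xs: "cont_terms xs" "\<And>t. t \<in> set xs \<Longrightarrow> \<bar>mono_degree t\<bar> \<le> int N"
    and u: "continuous_on UNIV u" "\<And>x. 0 \<le> u x" "\<And>x. u x \<le> 1" "u y = 1"
    and K: "y \<in> \<Delta> K" "\<And>x. x \<notin> \<Delta> K \<Longrightarrow> u x = 0"
    and van: "\<And>n x. 1 \<le> n \<Longrightarrow> n \<le> N \<Longrightarrow> x \<in> \<Delta> n \<Longrightarrow> u x = 0 \<or> u ((\<alpha> ^^ n) x) = 0"
    and cover: "(\<forall>(k, a, l)\<in>set xs. k \<le> K) \<or> (\<forall>x\<in>\<alpha> ` D. u x = 0)"
  shows "cmod (diag_sum_coeff D \<alpha> K xs y) \<le> norm (eval_terms \<pi> U xs)"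
proof -
  define f where "f x = complex_of_real (u x)" for x
  have f: "f \<in> cont_fun" unfolding f_def[abs_def] by (rule cont_fun_of_real[OF u(1)])
  have ff: "(\<lambda>x. f x * f x) \<in> cont_fun" by (rule cont_fun_mult[OF f f])
  let ?g = "val (K, f, K)"
  let ?ds = "degree_part 0 xs"
  have compress: "?g * eval_terms \<pi> U ys * ?g = eval_terms \<pi> U (degree_part 0 ys) * (?g * ?g)"
    if "set ys \<subseteq> set xs" "cont_terms ys" for ys
    using that
  proof (induction ys)
    case Nil
    then show ?case by (simp add: degree_part_def)
  next
    case (Cons t ys)
    obtain k a l where t: "t = (k, a, l)" by (cases t)
    have a: "a \<in> cont_fun" using Cons.prems t by simp
    have IH: "?g * eval_terms \<pi> U ys * ?g = eval_terms \<pi> U (degree_part 0 ys) * (?g * ?g)"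
      using Cons by simp
    show ?case
    proof (cases "k = l")
      case True
      have "?g * val t * ?g = val t * (?g * ?g)"
        using val_diag_commute[OF f a, of K k] by (simp add: t True mult.assoc[symmetric])
      then show ?thesis
        using IH by (simp add: distrib_left distrib_right degree_part_def t True mono_degree_def)
    next
      case False
      have "?g * val t * ?g = 0"
        unfolding t
      proof (rule bump_compress_mono[OF f _ _ _ a False])
        show "\<bar>mono_degree (k, a, l)\<bar> \<le> int N" using xs(2)[of t] Cons.prems by (simp add: t)
      qed (use K van in \<open>auto simp: f_def\<close>)
      then show ?thesis
        using IH False by (simp add: distrib_left distrib_right degree_part_def t mono_degree_def)
    qed
  qed
  have "eval_terms \<pi> U ?ds * (?g * ?g)
      = val (K, \<lambda>x. diag_sum_coeff D \<alpha> K ?ds x * (f x * f x), K)"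
    unfolding val_diag_mult[OF f f]
  proof (rule eval_diag_absorb)
    show "cont_terms ?ds" by (rule cont_terms_degree_part[OF xs(1)])
    show "(\<forall>(k, a, l)\<in>set ?ds. k \<le> K) \<or> (\<forall>x\<in>\<alpha> ` D. f x * f x = 0)"
      using cover by (auto simp: degree_part_def f_def)
  qed (use ff in \<open>auto simp: degree_part_def\<close>)
  then have eq: "?g * eval_terms \<pi> U xs * ?g
      = val (K, \<lambda>x. diag_sum_coeff D \<alpha> K xs x * (f x * f x), K)"
    using compress[of xs] xs(1) by (simp add: diag_sum_coeff_degree_part)
  have "cmod (diag_sum_coeff D \<alpha> K xs y) = cmod (diag_sum_coeff D \<alpha> K xs y * (f y * f y))"
    by (simp add: f_def u)
  also have "\<dots> \<le> norm (?g * eval_terms \<pi> U xs * ?g)"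
    unfolding eq
    by (rule norm_val_diag_ge[OF cont_fun_mult[OF diag_sum_coeff_cont[OF xs(1)] ff] K(1)])
  also have "\<dots> \<le> norm ?g * norm (eval_terms \<pi> U xs) * norm ?g"
    by (rule order_trans[OF norm_mult_ineq mult_right_mono[OF norm_mult_ineq norm_ge_zero]])
  also have "\<dots> \<le> 1 * norm (eval_terms \<pi> U xs) * 1"
  proof -
    have "norm ?g \<le> 1" by (rule norm_val_diag_le[OF f]) (simp_all add: f_def u)
    then show ?thesis by (intro mult_mono) auto
  qed
  finally show ?thesis by simp
qed

end

section \<open>Degree parts of products\<close>

lemma bop_apply_sum: "bop_apply (\<Sum>i\<in>I. T i) x = (\<Sum>i\<in>I. bop_apply (T i) x)"
  by (induction I rule: infinite_finite_induct) simp_all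

text \<open>All summands are positive, so the quadratic form of the sum at x bounds the squared norm
  of \<open>adj (T i)\<close> applied to x.\<close>

lemma norm_sq_le_norm_sum_mult_adj:
  assumes "finite I" "i \<in> I"
  shows "(norm (T i))\<^sup>2 \<le> norm (\<Sum>j\<in>I. T j * adj (T j))"
proof -
  let ?A = "\<Sum>j\<in>I. T j * adj (T j)"
  have "norm (adj (T i)) \<le> sqrt (norm ?A)"
  proof (rule norm_bop_leI)
    fix x
    have "(norm (bop_apply (adj (T i)) x))\<^sup>2 \<le> (\<Sum>j\<in>I. (norm (bop_apply (adj (T j)) x))\<^sup>2)"
      by (rule member_le_sum) (use assms in auto)
    also have "\<dots> = (\<Sum>j\<in>I. inner x (bop_apply (T j * adj (T j)) x))"
      by (rule sum.cong) (simp_all add: power2_norm_eq_inner inner_eq_Re_cinner cinner_adj_left)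
    also have "\<dots> = inner x (bop_apply ?A x)"
      by (simp only: bop_apply_sum inner_sum_right)
    also have "\<dots> \<le> norm x * norm (bop_apply ?A x)" by (rule norm_cauchy_schwarz)
    also have "\<dots> \<le> norm x * (norm ?A * norm x)"
      by (intro mult_left_mono norm_bop_apply_le norm_ge_zero)
    also have "\<dots> = (sqrt (norm ?A) * norm x)\<^sup>2"
      by (simp add: power_mult_distrib power2_eq_square)
    finally show "norm (bop_apply (adj (T i)) x) \<le> sqrt (norm ?A) * norm x"
      by (rule power2_le_imp_le) simp
  qed simp
  then have "(norm (adj (T i)))\<^sup>2 \<le> (sqrt (norm ?A))\<^sup>2" by (rule power_mono) simp
  then show ?thesis by simp
qed

lemma mono_degree_mult: "mono_degree (mono_mult D \<alpha> s t) = mono_degree s + mono_degree t"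
  by (cases s; cases t) (auto simp: mono_degree_def mono_mult_def)

lemma mono_degree_adj: "mono_degree (mono_adj t) = - mono_degree t"
  by (cases t) (simp add: mono_degree_def mono_adj_def)

lemma mult_terms_simps [simp]:
  "mult_terms D \<alpha> [] ys = []"
  "mult_terms D \<alpha> (t # xs) ys = map (mono_mult D \<alpha> t) ys @ mult_terms D \<alpha> xs ys"
  by (simp_all add: mult_terms_def)

lemma set_mult_terms:
  "set (mult_terms D \<alpha> xs ys) = (\<lambda>(s, t). mono_mult D \<alpha> s t) ` (set xs \<times> set ys)"
  by (auto simp: mult_terms_def)

lemma degree_part_simps [simp]:
  "degree_part d [] = []"
  "degree_part d (t # xs) = (if mono_degree t = d then t # degree_part d xs else degree_part d xs)"
  "degree_part d (xs @ ys) = degree_part d xs @ degree_part d ys"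
  by (simp_all add: degree_part_def)

lemma degree_part_map_mult:
  "degree_part d (map (mono_mult D \<alpha> t) ys) = map (mono_mult D \<alpha> t) (degree_part (d - mono_degree t) ys)"
  by (induction ys) (auto simp: mono_degree_mult)

lemma degree_part_map_adj: "degree_part d (map mono_adj xs) = map mono_adj (degree_part (- d) xs)"
  by (induction xs) (auto simp: mono_degree_adj)

lemma eval_degree_parts:
  assumes "finite S" "\<And>t. t \<in> set xs \<Longrightarrow> mono_degree t \<in> S"
  shows "eval_terms \<pi> U xs = (\<Sum>d\<in>S. eval_terms \<pi> U (degree_part d xs))"
  using assms(2)
proof (induction xs)
  case (Cons t xs)
  have "(\<Sum>d\<in>S. eval_terms \<pi> U (degree_part d (t # xs)))
      = (\<Sum>d\<in>S. (if mono_degree t = d then mono_val \<pi> U t else 0) + eval_terms \<pi> U (degree_part d xs))"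
    by (rule sum.cong) auto
  then show ?case using Cons assms(1) by (simp add: sum.distrib)
qed simp

context partial_system
begin

lemma mono_mult_cont:
  "fst (snd s) \<in> cont_fun \<Longrightarrow> fst (snd t) \<in> cont_fun \<Longrightarrow> fst (snd (mono_mult D \<alpha> s t)) \<in> cont_fun"
  by (cases s; cases t)
    (simp add: mono_mult_def cont_fun_mult endo_power_cont chi_iter_dom_cont)

lemma cont_terms_iff: "cont_terms xs \<longleftrightarrow> (\<forall>t\<in>set xs. fst (snd t) \<in> cont_fun)"
  by (auto simp: cont_terms_def split_beta)

lemma cont_terms_mult: "cont_terms xs \<Longrightarrow> cont_terms ys \<Longrightarrow> cont_terms (mult_terms D \<alpha> xs ys)"
  unfolding cont_terms_iff set_mult_terms using mono_mult_cont by auto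

lemma cont_terms_adj: "cont_terms xs \<Longrightarrow> cont_terms (map mono_adj xs)"
  unfolding cont_terms_iff by (auto simp: mono_adj_def cont_fun_cnj split_beta)

end

context cov_rep
begin

lemma val_mult': "fst (snd s) \<in> cont_fun \<Longrightarrow> fst (snd t) \<in> cont_fun \<Longrightarrow>
    val (mono_mult D \<alpha> s t) = val s * val t"
  by (cases s; cases t) (simp add: val_mult)

lemma eval_map_mult: "fst (snd t) \<in> cont_fun \<Longrightarrow> cont_terms ys \<Longrightarrow>
    eval_terms \<pi> U (map (mono_mult D \<alpha> t) ys) = val t * eval_terms \<pi> U ys"
  by (induction ys) (simp_all add: val_mult' distrib_left)

lemma eval_mult: "cont_terms xs \<Longrightarrow> cont_terms ys \<Longrightarrow>
    eval_terms \<pi> U (mult_terms D \<alpha> xs ys) = eval_terms \<pi> U xs * eval_terms \<pi> U ys"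
  by (induction xs) (simp_all add: eval_map_mult distrib_right)

lemma eval_adj: "cont_terms xs \<Longrightarrow> eval_terms \<pi> U (map mono_adj xs) = adj (eval_terms \<pi> U xs)"
proof (induction xs)
  case (Cons t xs)
  then show ?case by (cases t) (simp add: val_adj)
qed simp

lemma eval_degree_part_mult:
  assumes "finite S" "\<And>t. t \<in> set xs \<Longrightarrow> mono_degree t \<in> S" "cont_terms xs" "cont_terms ys"
  shows "eval_terms \<pi> U (degree_part e (mult_terms D \<alpha> xs ys))
    = (\<Sum>d\<in>S. eval_terms \<pi> U (degree_part d xs) * eval_terms \<pi> U (degree_part (e - d) ys))"
  using assms(2,3)
proof (induction xs)
  case (Cons t xs)
  have "(\<Sum>d\<in>S. eval_terms \<pi> U (degree_part d (t # xs)) * eval_terms \<pi> U (degree_part (e - d) ys))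
      = (\<Sum>d\<in>S. (if mono_degree t = d then val t * eval_terms \<pi> U (degree_part (e - d) ys) else 0)
          + eval_terms \<pi> U (degree_part d xs) * eval_terms \<pi> U (degree_part (e - d) ys))"
    by (rule sum.cong) (auto simp: distrib_right)
  also have "\<dots> = val t * eval_terms \<pi> U (degree_part (e - mono_degree t) ys)
      + (\<Sum>d\<in>S. eval_terms \<pi> U (degree_part d xs) * eval_terms \<pi> U (degree_part (e - d) ys))"
    using Cons.prems(1) assms(1) by (simp add: sum.distrib)
  finally show ?case
    using Cons by (simp add: degree_part_map_mult eval_map_mult cont_terms_degree_part assms(4))
qed simp

text \<open>In the product of x with its adjoint, degree 0 arises only from a homogeneous part and
  the adjoint of the same part. The degree 0 part is thus a sum of positive elements that dominates
  each homogeneous part, and the factor counts the degrees from -N to N in the triangle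
  inequality.\<close>

lemma norm_eval_le_diag:
  assumes "cont_terms xs" "\<And>t. t \<in> set xs \<Longrightarrow> \<bar>mono_degree t\<bar> \<le> int N"
  shows "(norm (eval_terms \<pi> U xs))\<^sup>2 \<le> (2 * real N + 1)\<^sup>2 *
    norm (eval_terms \<pi> U (degree_part 0 (mult_terms D \<alpha> xs (map mono_adj xs))))"
proof -
  define S where "S = {- int N..int N}"
  define X where "X d = eval_terms \<pi> U (degree_part d xs)" for d
  let ?A = "eval_terms \<pi> U (degree_part 0 (mult_terms D \<alpha> xs (map mono_adj xs)))"
  have S: "finite S" "mono_degree t \<in> S" if "t \<in> set xs" for t
    using assms(2)[OF that] by (auto simp: S_def)
  have fin: "finite S" by (simp add: S_def)
  have A: "?A = (\<Sum>d\<in>S. X d * adj (X d))"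
    unfolding X_def
    by (subst eval_degree_part_mult[OF fin S(2) assms(1) cont_terms_adj[OF assms(1)]])
      (simp_all add: degree_part_map_adj eval_adj cont_terms_degree_part assms(1))
  have Xle: "norm (X d) \<le> sqrt (norm ?A)" if "d \<in> S" for d
    using real_sqrt_le_mono[OF norm_sq_le_norm_sum_mult_adj[OF fin that, of X]]
    by (simp add: A)
  have "norm (eval_terms \<pi> U xs) = norm (\<Sum>d\<in>S. X d)"
    unfolding X_def by (subst eval_degree_parts[OF fin S(2)]) simp_all
  also have "\<dots> \<le> (\<Sum>d\<in>S. sqrt (norm ?A))"
    by (rule sum_norm_le[OF Xle])
  also have "\<dots> = (2 * real N + 1) * sqrt (norm ?A)" by (simp add: S_def)
  finally have "(norm (eval_terms \<pi> U xs))\<^sup>2 \<le> ((2 * real N + 1) * sqrt (norm ?A))\<^sup>2"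
    by (rule power_mono) simp
  then show ?thesis by (simp add: power_mult_distrib)
qed

end

section \<open>Comparison of two representations\<close>

text \<open>Write a / b = 1 + e with e > 0. Bernoulli's inequality for the exponent 2^n, then
  squared, makes the left side grow quadratically in 2^n, against a factor linear in 2^n.\<close>

lemma le_of_power_growth:
  fixes a b c :: real
  assumes "0 \<le> a" "0 \<le> b" "0 \<le> c"
    and pow: "\<And>n. a ^ (2 * 2 ^ n) \<le> (c * 2 ^ n + 1) * b ^ (2 * 2 ^ n)"
  shows "a \<le> b"
proof (rule ccontr)
  assume "\<not> a \<le> b"
  then have "b < a" by simp
  show False
  proof (cases "b = 0")
    case True
    then show False using pow[of 0] \<open>b < a\<close> by (simp add: power2_eq_square mult_le_0_iff)
  next
    case False
    then have "0 < b" using assms by simp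
    define e where "e = a / b - 1"
    have e: "0 < e" using \<open>b < a\<close> \<open>0 < b\<close> by (simp add: e_def)
    have bound: "2 ^ n * e\<^sup>2 \<le> c" for n
    proof -
      define m :: real where "m = 2 ^ n"
      have m: "0 < m" by (simp add: m_def)
      have "(1 + e) ^ (2 * 2 ^ n) = a ^ (2 * 2 ^ n) / b ^ (2 * 2 ^ n)"
        by (simp add: e_def power_divide)
      also have "\<dots> \<le> c * m + 1"
        using pow[of n] \<open>0 < b\<close> by (simp add: m_def divide_le_eq)
      finally have 1: "(1 + e) ^ (2 * 2 ^ n) \<le> c * m + 1" .
      have "1 + m * e \<le> (1 + e) ^ (2 ^ n)"
        using Bernoulli_inequality[of e "2 ^ n"] e by (simp add: m_def)
      then have "(1 + m * e)\<^sup>2 \<le> ((1 + e) ^ (2 ^ n))\<^sup>2"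
        by (rule power_mono) (use m e in simp)
      also have "\<dots> = (1 + e) ^ (2 * 2 ^ n)" by (simp add: mult.commute flip: power_mult)
      finally have "(1 + m * e)\<^sup>2 \<le> c * m + 1" using 1 by simp
      moreover have "(1 + m * e)\<^sup>2 = 1 + 2 * (m * e) + m * (m * e\<^sup>2)"
        by (simp add: power2_eq_square algebra_simps)
      moreover have "0 < m * e" using m e by simp
      ultimately have "m * (m * e\<^sup>2) \<le> m * c" by (simp add: mult.commute)
      then show ?thesis using m by (simp add: m_def)
    qed
    obtain n where "c / e\<^sup>2 < real n" using reals_Archimedean2 by blast
    also have "real n < 2 ^ n" by simp
    finally have "c < 2 ^ n * e\<^sup>2" using e by (simp add: divide_less_eq)
    then show False using bound[of n] by simp
  qed
qed

context partial_system
begin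

text \<open>A periodic point is the image of its predecessor on the orbit. Points off the image are
  thus aperiodic by themselves, and freeness is called upon only at the top level M.\<close>

lemma image_not_periodic:
  assumes "x \<notin> \<alpha> ` D" "1 \<le> n"
  shows "x \<notin> periodic_points D \<alpha> n"
proof
  assume x: "x \<in> periodic_points D \<alpha> n"
  obtain j where n: "n = Suc j" using assms(2) by (cases n) auto
  have "(\<alpha> ^^ j) x \<in> D" "x = \<alpha> ((\<alpha> ^^ j) x)"
    using x by (simp_all add: periodic_points_def iter_dom_def n)
  then show False using assms(1) by blast
qed

text \<open>The first representation bounds the degree 0 part from above by the functions c_N, the
  second bounds these by the norm of the whole sum; both use the same c_N.\<close>

lemma norm_diag_le_norm_eval:
  fixes \<pi>\<^sub>1 :: "('x \<Rightarrow> complex) \<Rightarrow> 'h1::chilbert_space bop"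
    and \<pi>\<^sub>2 :: "('x \<Rightarrow> complex) \<Rightarrow> 'h2::chilbert_space bop"
  assumes "cov_rep D \<alpha> \<pi>\<^sub>1 U\<^sub>1" "cov_rep D \<alpha> \<pi>\<^sub>2 U\<^sub>2"
    and free: "topologically_free D \<alpha>" and xs: "cont_terms xs"
  shows "norm (eval_terms \<pi>\<^sub>1 U\<^sub>1 (degree_part 0 xs)) \<le> norm (eval_terms \<pi>\<^sub>2 U\<^sub>2 xs)"
proof -
  interpret r1: cov_rep D \<alpha> \<pi>\<^sub>1 U\<^sub>1 by fact
  interpret r2: cov_rep D \<alpha> \<pi>\<^sub>2 U\<^sub>2 by fact
  obtain M where "\<forall>k\<in>fst ` set xs. k \<le> M"
    using finite_nat_set_iff_bounded_le[of "fst ` set xs"] by auto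
  then have M: "k \<le> M" if "(k, a, l) \<in> set xs" for k a l using that by force
  obtain N where "\<forall>n\<in>(\<lambda>t. nat \<bar>mono_degree t\<bar>) ` set xs. n \<le> N"
    using finite_nat_set_iff_bounded_le[of "(\<lambda>t. nat \<bar>mono_degree t\<bar>) ` set xs"] by auto
  then have N: "\<bar>mono_degree t\<bar> \<le> int N" if "t \<in> set xs" for t using that by force
  let ?s = "norm (eval_terms \<pi>\<^sub>2 U\<^sub>2 xs)"
  show ?thesis
  proof (rule r1.norm_eval_diag_le[where M = M])
    show "cont_terms (degree_part 0 xs)" by (rule cont_terms_degree_part[OF xs])
    show "mono_degree t = 0" if "t \<in> set (degree_part 0 xs)" for t
      using that by (simp add: degree_part_def)
    show "\<forall>(k, a, l)\<in>set (degree_part 0 xs). k \<le> M" using M by (auto simp: degree_part_def)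
    show "cmod (diag_sum_coeff D \<alpha> K (degree_part 0 xs) x) \<le> ?s"
      if "K < M" and x: "x \<in> \<Delta> K" "x \<notin> \<alpha> ` D" for K x
    proof -
      \<comment> \<open>Exponents above K may occur here, so the bump has to vanish on the image of
        \<alpha> for the compression to see c_K.\<close>
      have W: "open (\<Delta> K \<inter> - \<alpha> ` D)" "x \<in> \<Delta> K \<inter> - \<alpha> ` D"
        using x closed_image by (auto intro: open_iter_dom)
      obtain u :: "'x \<Rightarrow> real" where u: "continuous_on UNIV u" "\<And>x. 0 \<le> u x" "\<And>x. u x \<le> 1" "u x = 1"
        "\<And>z. z \<notin> \<Delta> K \<inter> - \<alpha> ` D \<Longrightarrow> u z = 0"
        "\<And>n z. 1 \<le> n \<Longrightarrow> n \<le> N \<Longrightarrow> z \<in> \<Delta> n \<Longrightarrow> u z = 0 \<or> u ((\<alpha> ^^ n) z) = 0"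
        by (rule aperiodic_bump[OF W, where N = N])
          (use image_not_periodic[OF x(2)] in blast, rule that, blast+)
      have "cmod (diag_sum_coeff D \<alpha> K xs x) \<le> ?s"
        by (rule r2.coeff_le_norm_eval[OF xs N u(1-4) x(1) _ u(6)]) (use u(5) in auto)
      then show ?thesis by (simp add: diag_sum_coeff_degree_part)
    qed
    show "cmod (diag_sum_coeff D \<alpha> M (degree_part 0 xs) x) \<le> ?s" if "x \<in> \<Delta> M" for x
    proof (rule ccontr)
      assume neg: "\<not> ?thesis"
      \<comment> \<open>A violation at one point persists on an open set, as freeness requires; it
        will be contradicted at a preimage of one of its points.\<close>
      define V where "V = \<Delta> M \<inter> {z. ?s < cmod (diag_sum_coeff D \<alpha> M xs z)}"
      have V: "open V" unfolding V_def
        by (intro open_Int open_iter_dom open_Collect_less continuous_on_const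
            continuous_on_norm_cont_fun diag_sum_coeff_cont xs)
      have V': "V \<noteq> {}" using that neg by (auto simp: V_def diag_sum_coeff_degree_part)
      obtain j y where y: "y \<in> \<Delta> j" "(\<alpha> ^^ j) y \<in> V"
        "\<And>n. 1 \<le> n \<Longrightarrow> n \<le> N \<Longrightarrow> y \<notin> periodic_points D \<alpha> n"
        by (rule topologically_free_aperiodic[OF free V V', where N = N]) (rule that, blast+)
      have yM: "y \<in> \<Delta> (M + j)"
        using y(1,2) iter_dom_add[of y D \<alpha> j M] by (simp add: V_def add.commute)
      obtain u :: "'x \<Rightarrow> real" where u: "continuous_on UNIV u" "\<And>x. 0 \<le> u x" "\<And>x. u x \<le> 1" "u y = 1"
        "\<And>z. z \<notin> \<Delta> (M + j) \<Longrightarrow> u z = 0"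
        "\<And>n z. 1 \<le> n \<Longrightarrow> n \<le> N \<Longrightarrow> z \<in> \<Delta> n \<Longrightarrow> u z = 0 \<or> u ((\<alpha> ^^ n) z) = 0"
        by (rule aperiodic_bump[OF open_iter_dom yM, where N = N]) (use y(3) in blast, rule that, blast+)
      have "cmod (diag_sum_coeff D \<alpha> (M + j) xs y) \<le> ?s"
        by (rule r2.coeff_le_norm_eval[OF xs N u(1-4) yM u(5,6)]) (use M in \<open>auto intro: trans_le_add1\<close>)
      moreover have "diag_sum_coeff D \<alpha> (M + j) xs y = diag_sum_coeff D \<alpha> M xs ((\<alpha> ^^ j) y)"
        by (rule diag_sum_coeff_lift[OF M y(1)]) (use y(2) in \<open>auto simp: V_def\<close>)
      ultimately show False using y(2) by (simp add: V_def)
    qed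
  qed simp
qed

text \<open>The bound up to a factor linear in the degree is applied to the powers \<open>(x x*)\<^sup>p\<close>,
  \<open>p = 2\<^sup>n\<close>; the \<open>p\<close>-th root of the factor tends to 1.\<close>

lemma norm_eval_mono:
  fixes \<pi>\<^sub>1 :: "('x \<Rightarrow> complex) \<Rightarrow> 'h1::chilbert_space bop"
    and \<pi>\<^sub>2 :: "('x \<Rightarrow> complex) \<Rightarrow> 'h2::chilbert_space bop"
  assumes reps: "cov_rep D \<alpha> \<pi>\<^sub>1 U\<^sub>1" "cov_rep D \<alpha> \<pi>\<^sub>2 U\<^sub>2"
    and free: "topologically_free D \<alpha>" and xs: "cont_terms xs"
  shows "norm (eval_terms \<pi>\<^sub>1 U\<^sub>1 xs) \<le> norm (eval_terms \<pi>\<^sub>2 U\<^sub>2 xs)"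
proof -
  interpret r1: cov_rep D \<alpha> \<pi>\<^sub>1 U\<^sub>1 by fact
  interpret r2: cov_rep D \<alpha> \<pi>\<^sub>2 U\<^sub>2 by fact
  have crude: "norm (eval_terms \<pi>\<^sub>1 U\<^sub>1 ys) \<le> (2 * real N + 1) * norm (eval_terms \<pi>\<^sub>2 U\<^sub>2 ys)"
    if ys: "cont_terms ys" "\<And>t. t \<in> set ys \<Longrightarrow> \<bar>mono_degree t\<bar> \<le> int N" for ys N
  proof -
    let ?z = "mult_terms D \<alpha> ys (map mono_adj ys)"
    have z: "cont_terms ?z" by (intro cont_terms_mult cont_terms_adj ys)
    have "(norm (eval_terms \<pi>\<^sub>1 U\<^sub>1 ys))\<^sup>2
        \<le> (2 * real N + 1)\<^sup>2 * norm (eval_terms \<pi>\<^sub>1 U\<^sub>1 (degree_part 0 ?z))"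
      by (rule r1.norm_eval_le_diag[OF ys])
    also have "\<dots> \<le> (2 * real N + 1)\<^sup>2 * norm (eval_terms \<pi>\<^sub>2 U\<^sub>2 ?z)"
      by (intro mult_left_mono norm_diag_le_norm_eval[OF reps free z]) simp
    also have "norm (eval_terms \<pi>\<^sub>2 U\<^sub>2 ?z) = (norm (eval_terms \<pi>\<^sub>2 U\<^sub>2 ys))\<^sup>2"
      by (simp add: r2.eval_mult r2.eval_adj ys cont_terms_adj norm_mult_adj)
    finally have "(norm (eval_terms \<pi>\<^sub>1 U\<^sub>1 ys))\<^sup>2 \<le> ((2 * real N + 1) * norm (eval_terms \<pi>\<^sub>2 U\<^sub>2 ys))\<^sup>2"
      by (simp add: power_mult_distrib)
    then show ?thesis by (rule power2_le_imp_le) simp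
  qed
  obtain N where "\<forall>n\<in>(\<lambda>t. nat \<bar>mono_degree t\<bar>) ` set xs. n \<le> N"
    using finite_nat_set_iff_bounded_le[of "(\<lambda>t. nat \<bar>mono_degree t\<bar>) ` set xs"] by auto
  then have N: "\<bar>mono_degree t\<bar> \<le> int N" if "t \<in> set xs" for t using that by force
  \<comment> \<open>Repeated squaring: z n evaluates to the 2^n-th power of x times its adjoint. The
    degree bound doubles at each step, starting from 2 N, while the norm is squared.\<close>
  define z where "z n = ((\<lambda>y. mult_terms D \<alpha> y y) ^^ n) (mult_terms D \<alpha> xs (map mono_adj xs))" for n
  have z0: "z 0 = mult_terms D \<alpha> xs (map mono_adj xs)" by (simp add: z_def)
  have zS: "z (Suc n) = mult_terms D \<alpha> (z n) (z n)" for n by (simp add: z_def)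
  have zc: "cont_terms (z n)" for n
    by (induction n) (simp_all add: z0 zS cont_terms_mult cont_terms_adj xs)
  have zdeg: "\<forall>t\<in>set (z n). \<bar>mono_degree t\<bar> \<le> int (2 * 2 ^ n * N)" for n
  proof (induction n)
    case 0
    have "\<bar>mono_degree s - mono_degree t\<bar> \<le> int (2 * N)" if "s \<in> set xs" "t \<in> set xs" for s t
      using N[OF that(1)] N[OF that(2)] by linarith
    then show ?case by (auto simp: z0 set_mult_terms mono_degree_mult mono_degree_adj)
  next
    case (Suc n)
    have "\<bar>mono_degree s + mono_degree t\<bar> \<le> int (2 * 2 ^ Suc n * N)" if "s \<in> set (z n)" "t \<in> set (z n)" for s t
      using bspec[OF Suc that(1)] bspec[OF Suc that(2)] by simp
    then show ?case by (auto simp: zS set_mult_terms mono_degree_mult)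
  qed
  have znorm: "norm (eval_terms \<pi> U (z n)) = norm (eval_terms \<pi> U xs) ^ (2 * 2 ^ n)"
    if "cov_rep D \<alpha> \<pi> U" for \<pi> :: "('x \<Rightarrow> complex) \<Rightarrow> 'k::chilbert_space bop" and U n
  proof -
    interpret r: cov_rep D \<alpha> \<pi> U by fact
    \<comment> \<open>Self-adjointness gives the square of z n the form \<open>T * adj T\<close>,
      whose norm is exactly the square of the norm of T.\<close>
    have z_adj: "adj (eval_terms \<pi> U (z n)) = eval_terms \<pi> U (z n)" for n
      by (induction n) (simp_all add: z0 zS zc r.eval_mult r.eval_adj xs cont_terms_adj)
    show ?thesis
    proof (induction n)
      case 0
      then show ?case by (simp add: z0 r.eval_mult r.eval_adj xs cont_terms_adj norm_mult_adj)
    next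
      case (Suc n)
      have "eval_terms \<pi> U (z (Suc n)) = eval_terms \<pi> U (z n) * adj (eval_terms \<pi> U (z n))"
        by (simp add: z_adj zS r.eval_mult zc)
      then have "norm (eval_terms \<pi> U (z (Suc n))) = (norm (eval_terms \<pi> U (z n)))\<^sup>2"
        by (simp only: norm_mult_adj)
      also have "\<dots> = norm (eval_terms \<pi> U xs) ^ (2 * 2 ^ Suc n)"
        unfolding Suc by (simp add: mult_ac flip: power_mult)
      finally show ?case .
    qed
  qed
  show ?thesis
  proof (rule le_of_power_growth)
    fix n
    have "norm (eval_terms \<pi>\<^sub>1 U\<^sub>1 (z n)) \<le> (2 * real (2 * 2 ^ n * N) + 1) * norm (eval_terms \<pi>\<^sub>2 U\<^sub>2 (z n))"
      by (rule crude[OF zc]) (use zdeg in blast)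
    then show "norm (eval_terms \<pi>\<^sub>1 U\<^sub>1 xs) ^ (2 * 2 ^ n)
        \<le> (4 * real N * 2 ^ n + 1) * norm (eval_terms \<pi>\<^sub>2 U\<^sub>2 xs) ^ (2 * 2 ^ n)"
      by (simp add: znorm[OF reps(1)] znorm[OF reps(2)] mult_ac)
  qed simp_all
qed

end

section \<open>Isometric extension to the generated algebras\<close>

lemma star_subalgebra_closure:
  assumes "star_subalgebra B"
  shows "star_subalgebra (closure B)"
proof -
  have ops: "0 \<in> B" "\<And>S T. S \<in> B \<Longrightarrow> T \<in> B \<Longrightarrow> S + T \<in> B" "\<And>S T. S \<in> B \<Longrightarrow> T \<in> B \<Longrightarrow> S * T \<in> B"
    "\<And>c T. T \<in> B \<Longrightarrow> c *\<^sub>C T \<in> B" "\<And>T. T \<in> B \<Longrightarrow> adj T \<in> B"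
    using assms by (auto simp: star_subalgebra_def)
  have lim: "S \<in> closure B" if "\<And>n. X n \<in> B" "X \<longlonglongrightarrow> S" for X S
    using that unfolding closure_sequential by blast
  have two: "S + T \<in> closure B \<and> S * T \<in> closure B" if ST: "S \<in> closure B" "T \<in> closure B" for S T
  proof -
    obtain X Y where X: "\<And>n. X n \<in> B" "X \<longlonglongrightarrow> S" and Y: "\<And>n. Y n \<in> B" "Y \<longlonglongrightarrow> T"
      using ST by (auto simp: closure_sequential)
    have "(\<lambda>n. X n + Y n) \<longlonglongrightarrow> S + T" "(\<lambda>n. X n * Y n) \<longlonglongrightarrow> S * T"
      by (intro tendsto_intros X Y)+
    then show ?thesis using lim[OF ops(2)[OF X(1) Y(1)]] lim[OF ops(3)[OF X(1) Y(1)]] by simp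
  qed
  have one: "c *\<^sub>C T \<in> closure B \<and> adj T \<in> closure B" if T: "T \<in> closure B" for c T
  proof -
    obtain Y where Y: "\<And>n. Y n \<in> B" "Y \<longlonglongrightarrow> T"
      using T by (auto simp: closure_sequential)
    have "(\<lambda>n. c *\<^sub>C Y n) \<longlonglongrightarrow> c *\<^sub>C T" "(\<lambda>n. adj (Y n)) \<longlonglongrightarrow> adj T"
      by (intro bounded_linear.tendsto[OF bounded_linear_bop_scaleC]
          bounded_linear.tendsto[OF bounded_linear_adj] Y)+
    then show ?thesis using lim[OF ops(4)[OF Y(1)]] lim[OF ops(5)[OF Y(1)]] by simp
  qed
  have "0 \<in> closure B" using ops(1) closure_subset by blast
  then show ?thesis unfolding star_subalgebra_def using two one by blast
qed

text \<open>A relation is used because the operators come from lists, and it is the isometry,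
  applied to differences, that makes the correspondence single-valued in both directions. It also
  transfers the Cauchy property between paired sequences, so completeness on both sides extends the
  correspondence to the closures.\<close>

lemma star_isomorphism_of_isometric_relation:
  fixes R :: "'h1::chilbert_space bop \<Rightarrow> 'h2::chilbert_space bop \<Rightarrow> bool"
  assumes norm: "\<And>S T. R S T \<Longrightarrow> norm S = norm T"
    and add: "\<And>S T S' T'. R S T \<Longrightarrow> R S' T' \<Longrightarrow> R (S + S') (T + T')"
    and mult: "\<And>S T S' T'. R S T \<Longrightarrow> R S' T' \<Longrightarrow> R (S * S') (T * T')"
    and scale: "\<And>S T c. R S T \<Longrightarrow> R (c *\<^sub>C S) (c *\<^sub>C T)"
    and adj: "\<And>S T. R S T \<Longrightarrow> R (adj S) (adj T)"
  shows "\<exists>\<Phi>. star_isomorphism \<Phi> (closure {S. \<exists>T. R S T}) (closure {T. \<exists>S. R S T})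
    \<and> (\<forall>S T. R S T \<longrightarrow> \<Phi> S = T)"
proof -
  \<comment> \<open>C is the closure of R in the product of the two operator spaces; it will be the
    graph of the isomorphism.\<close>
  define C where "C S T \<longleftrightarrow> (\<exists>X Y. (\<forall>n. R (X n) (Y n)) \<and> X \<longlonglongrightarrow> S \<and> Y \<longlonglongrightarrow> T)" for S T
  have diff: "R (S - S') (T - T')" if "R S T" "R S' T'" for S S' T T'
  proof -
    have m: "- A = (- 1) *\<^sub>C A" for A :: "'k::chilbert_space bop"
      by (rule bop_ext) (metis bop_apply_simps(3,7) complex_scaleC_minus scaleR_scaleC
          of_real_1 of_real_minus scaleR_minus1_left)
    show ?thesis
      using add[OF that(1) scale[OF that(2), of "- 1"]] by (simp flip: m)
  qed
  have RC: "C S T" if "R S T" for S T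
    unfolding C_def by (rule exI[of _ "\<lambda>_. S"], rule exI[of _ "\<lambda>_. T"]) (simp add: that)
  have C_add: "C (S + S') (T + T')" and C_mult: "C (S * S') (T * T')" and C_diff: "C (S - S') (T - T')"
    if "C S T" "C S' T'" for S S' T T'
  proof -
    obtain X Y X' Y' where *: "\<And>n. R (X n) (Y n)" "X \<longlonglongrightarrow> S" "Y \<longlonglongrightarrow> T"
      "\<And>n. R (X' n) (Y' n)" "X' \<longlonglongrightarrow> S'" "Y' \<longlonglongrightarrow> T'"
      using \<open>C S T\<close> \<open>C S' T'\<close> unfolding C_def by blast
    show "C (S + S') (T + T')" unfolding C_def
      by (rule exI[of _ "\<lambda>n. X n + X' n"], rule exI[of _ "\<lambda>n. Y n + Y' n"])
        (intro conjI allI add tendsto_intros *)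
    show "C (S * S') (T * T')" unfolding C_def
      by (rule exI[of _ "\<lambda>n. X n * X' n"], rule exI[of _ "\<lambda>n. Y n * Y' n"])
        (intro conjI allI mult tendsto_intros *)
    show "C (S - S') (T - T')" unfolding C_def
      by (rule exI[of _ "\<lambda>n. X n - X' n"], rule exI[of _ "\<lambda>n. Y n - Y' n"])
        (intro conjI allI diff tendsto_intros *)
  qed
  have C_scale: "C (c *\<^sub>C S) (c *\<^sub>C T)" and C_adj: "C (adj S) (adj T)" if CST: "C S T" for S T c
  proof -
    obtain X Y where *: "\<And>n. R (X n) (Y n)" "X \<longlonglongrightarrow> S" "Y \<longlonglongrightarrow> T"
      using CST unfolding C_def by blast
    show "C (c *\<^sub>C S) (c *\<^sub>C T)" unfolding C_def
      by (rule exI[of _ "\<lambda>n. c *\<^sub>C X n"], rule exI[of _ "\<lambda>n. c *\<^sub>C Y n"])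
        (intro conjI allI scale bounded_linear.tendsto[OF bounded_linear_bop_scaleC] *)
    show "C (adj S) (adj T)" unfolding C_def
      by (rule exI[of _ "\<lambda>n. adj (X n)"], rule exI[of _ "\<lambda>n. adj (Y n)"])
        (intro conjI allI adj bounded_linear.tendsto[OF bounded_linear_adj] *)
  qed
  have C_norm: "norm S = norm T" if CST: "C S T" for S T
  proof -
    obtain X Y where *: "\<And>n. R (X n) (Y n)" "X \<longlonglongrightarrow> S" "Y \<longlonglongrightarrow> T"
      using CST unfolding C_def by blast
    have "(\<lambda>n. norm (X n)) \<longlonglongrightarrow> norm S" "(\<lambda>n. norm (Y n)) \<longlonglongrightarrow> norm T"
      by (intro tendsto_norm *)+
    then show ?thesis using norm[OF *(1)] LIMSEQ_unique by auto
  qed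
  have C_left_unique: "S = S'" if "C S T" "C S' T" for S S' T
    using C_norm[OF C_diff[OF that]] by simp
  have C_right_unique: "T = T'" if "C S T" "C S T'" for S T T'
    using C_norm[OF C_diff[OF that]] by simp
  have Cauchy_iff: "Cauchy X \<longleftrightarrow> Cauchy Y" if "\<And>n. R (X n) (Y n)" for X Y
    using norm[OF diff[OF that that]] by (simp add: Cauchy_def dist_norm)
  have C_left: "\<exists>T. C S T" if S: "S \<in> closure {S. \<exists>T. R S T}" for S
  proof -
    obtain X where X: "\<And>n. \<exists>T. R (X n) T" "X \<longlonglongrightarrow> S" using S by (auto simp: closure_sequential)
    then obtain Y where Y: "\<And>n. R (X n) (Y n)" by metis
    have "Cauchy Y" using Cauchy_iff[OF Y] LIMSEQ_imp_Cauchy[OF X(2)] by simp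
    then have "convergent Y" by (rule Cauchy_convergent)
    then obtain T where "Y \<longlonglongrightarrow> T" unfolding convergent_def by blast
    then have "C S T" unfolding C_def using X(2) Y by (intro exI[of _ X] exI[of _ Y]) simp
    then show ?thesis by blast
  qed
  have C_right: "\<exists>S. C S T" if T: "T \<in> closure {T. \<exists>S. R S T}" for T
  proof -
    obtain Y where Y: "\<And>n. \<exists>S. R S (Y n)" "Y \<longlonglongrightarrow> T" using T by (auto simp: closure_sequential)
    then obtain X where X: "\<And>n. R (X n) (Y n)" by metis
    have "Cauchy X" using Cauchy_iff[OF X] LIMSEQ_imp_Cauchy[OF Y(2)] by simp
    then have "convergent X" by (rule Cauchy_convergent)
    then obtain S where "X \<longlonglongrightarrow> S" unfolding convergent_def by blast
    then have "C S T" unfolding C_def using X Y(2) by (intro exI[of _ X] exI[of _ Y]) simp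
    then show ?thesis by blast
  qed
  have C_dom: "S \<in> closure {S. \<exists>T. R S T}" "T \<in> closure {T. \<exists>S. R S T}" if "C S T" for S T
    using that unfolding C_def closure_sequential by blast+
  define \<Phi> where "\<Phi> S = (THE T. C S T)" for S
  have \<Phi>: "\<Phi> S = T" if "C S T" for S T
    unfolding \<Phi>_def using that C_right_unique by blast
  have C\<Phi>: "C S (\<Phi> S)" if "S \<in> closure {S. \<exists>T. R S T}" for S
    using C_left[OF that] \<Phi> by blast
  have "bij_betw \<Phi> (closure {S. \<exists>T. R S T}) (closure {T. \<exists>S. R S T})"
    unfolding bij_betw_def
  proof
    show "inj_on \<Phi> (closure {S. \<exists>T. R S T})"
    proof (rule inj_onI)
      fix S S' assume S: "S \<in> closure {S. \<exists>T. R S T}" "S' \<in> closure {S. \<exists>T. R S T}" "\<Phi> S = \<Phi> S'"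
      show "S = S'" by (rule C_left_unique[OF C\<Phi>[OF S(1)]]) (use C\<Phi>[OF S(2)] S(3) in simp)
    qed
    show "\<Phi> ` closure {S. \<exists>T. R S T} = closure {T. \<exists>S. R S T}"
    proof (intro equalityI subsetI)
      fix T assume "T \<in> closure {T. \<exists>S. R S T}"
      then obtain S where ST: "C S T" using C_right by blast
      show "T \<in> \<Phi> ` closure {S. \<exists>T. R S T}"
        by (rule image_eqI[where x = S], rule \<Phi>[OF ST, symmetric], rule C_dom(1)[OF ST])
    next
      fix T assume "T \<in> \<Phi> ` closure {S. \<exists>T. R S T}"
      then obtain S where "S \<in> closure {S. \<exists>T. R S T}" "T = \<Phi> S" by (rule imageE)
      then show "T \<in> closure {T. \<exists>S. R S T}" using C_dom(2)[OF C\<Phi>] by simp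
    qed
  qed
  then have "star_isomorphism \<Phi> (closure {S. \<exists>T. R S T}) (closure {T. \<exists>S. R S T})"
    unfolding star_isomorphism_def
    by (intro conjI ballI allI \<Phi> C_add C_mult C_scale C_adj C\<Phi>)
  moreover have "\<forall>S T. R S T \<longrightarrow> \<Phi> S = T" by (intro allI impI \<Phi> RC)
  ultimately show ?thesis by (intro exI[of _ \<Phi>] conjI)
qed

section \<open>The span of the monomials as a dense subalgebra\<close>

definition mono_scale where "mono_scale c = (\<lambda>(k, a, l). (k, \<lambda>x. c * a x, l))"

text \<open>The term for \<open>U*\<^sup>k \<pi>(a) U\<^sup>k U\<^sup>n\<close> with \<open>n\<close> an integer.\<close>

definition mono_shift where
  "mono_shift D \<alpha> n k a =
    (if 0 \<le> n then (k, a, k + nat n) else mono_mult D \<alpha> (k, a, k) (nat (- n), \<lambda>x. 1, 0))"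

lemma mono_degree_shift: "mono_degree (mono_shift D \<alpha> n k a) = n"
  by (cases "0 \<le> n") (simp_all add: mono_shift_def mono_degree_mult, simp_all add: mono_degree_def)

context partial_system
begin

lemma mono_shift_cont: "a \<in> cont_fun \<Longrightarrow> fst (snd (mono_shift D \<alpha> n k a)) \<in> cont_fun"
  by (simp add: mono_shift_def mono_mult_cont)

lemma mono_scale_cont: "cont_terms xs \<Longrightarrow> cont_terms (map (mono_scale c) xs)"
proof (induction xs)
  case (Cons t xs)
  then show ?case
    by (cases t) (simp add: mono_scale_def cont_fun_mult[OF cont_fun_const])
qed simp

end

context cov_rep
begin

lemma eval_scale: "cont_terms xs \<Longrightarrow> eval_terms \<pi> U (map (mono_scale c) xs) = c *\<^sub>C eval_terms \<pi> U xs"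
proof (induction xs)
  case Nil
  show ?case by (rule bop_ext) (simp add: complex_scaleC_zero)
next
  case (Cons t xs)
  obtain k a l where t: "t = (k, a, l)" by (cases t)
  have "val (mono_scale c t) = c *\<^sub>C val t"
    using Cons.prems by (intro bop_ext) (simp add: t mono_scale_def mono_val_def pi_scale bop_apply_scaleC)
  then show ?case using Cons by (simp add: scaleC_add_right)
qed

lemma val_shift:
  assumes a: "a \<in> cont_fun"
  shows "val (mono_shift D \<alpha> n k a) = adj U ^ k * \<pi> a * U ^ k * zpow U n"
proof (cases "0 \<le> n")
  case True
  then show ?thesis by (simp add: mono_shift_def mono_val_def zpow_def power_add mult.assoc)
next
  case False
  \<comment> \<open>The exponent is positive, so a factor \<open>adj U\<close> is available to
    absorb the \<pi> 1 in the triple \<open>(Suc m, \<lambda>x. 1, 0)\<close>.\<close>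
  then obtain m where m: "nat (- n) = Suc m" by (cases "nat (- n)") auto
  have "adj U * \<pi> (\<lambda>x. 1) = adj U"
  proof -
    have "adj (\<pi> (\<lambda>x. 1)) = \<pi> (\<lambda>x. 1)" using pi_cnj[of "\<lambda>x. 1"] by simp
    then show ?thesis using arg_cong[OF pi_one_U, of adj] by simp
  qed
  then have "val (Suc m, \<lambda>x. 1, 0) = adj U ^ Suc m"
    unfolding mono_val_def prod.case power_Suc2 by (simp add: mult.assoc)
  moreover have "val (mono_shift D \<alpha> n k a) = val (k, a, k) * val (Suc m, \<lambda>x. 1, 0)"
    using False m by (simp add: mono_shift_def val_mult a)
  moreover have "zpow U n = adj U ^ Suc m" using False by (simp only: zpow_def m if_False)
  ultimately show ?thesis by (simp only: mono_val_def prod.case)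
qed

lemma star_subalgebra_eval: "star_subalgebra {eval_terms \<pi> U xs |xs. cont_terms xs}"
proof -
  let ?B = "{eval_terms \<pi> U xs |xs. cont_terms xs}"
  have "eval_terms \<pi> U [] \<in> ?B" by (intro CollectI exI[of _ "[]"]) simp
  moreover have "eval_terms \<pi> U xs + eval_terms \<pi> U ys \<in> ?B" "eval_terms \<pi> U xs * eval_terms \<pi> U ys \<in> ?B"
    "c *\<^sub>C eval_terms \<pi> U xs \<in> ?B" "adj (eval_terms \<pi> U xs) \<in> ?B"
    if "cont_terms xs" "cont_terms ys" for xs ys c
  proof -
    show "eval_terms \<pi> U xs + eval_terms \<pi> U ys \<in> ?B"
      using that by (intro CollectI exI[of _ "xs @ ys"]) simp
    show "eval_terms \<pi> U xs * eval_terms \<pi> U ys \<in> ?B"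
      using that by (intro CollectI exI[of _ "mult_terms D \<alpha> xs ys"]) (simp add: eval_mult cont_terms_mult)
    show "c *\<^sub>C eval_terms \<pi> U xs \<in> ?B"
      using that by (intro CollectI exI[of _ "map (mono_scale c) xs"]) (simp add: eval_scale mono_scale_cont)
    show "adj (eval_terms \<pi> U xs) \<in> ?B"
      using that by (intro CollectI exI[of _ "map mono_adj xs"]) (simp add: eval_adj cont_terms_adj)
  qed
  ultimately show ?thesis unfolding star_subalgebra_def by auto
qed

lemma cstar_generated_eq: "cstar_generated (\<pi> ` cont_fun \<union> {U}) = closure {eval_terms \<pi> U xs |xs. cont_terms xs}"
proof
  let ?B = "{eval_terms \<pi> U xs |xs. cont_terms xs}"
  have "\<pi> a \<in> ?B" if "a \<in> cont_fun" for a
    using that by (intro CollectI exI[of _ "[(0, a, 0)]"]) (simp add: mono_val_def)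
  \<comment> \<open>The triple \<open>(0, \<lambda>x. 1, 1)\<close> evaluates to U because U absorbs
    \<pi> 1 on the left.\<close>
  moreover have "U \<in> ?B"
    by (intro CollectI exI[of _ "[(0, \<lambda>x. 1, 1)]"]) (simp add: mono_val_def pi_one_U)
  ultimately have "\<pi> ` cont_fun \<union> {U} \<subseteq> closure ?B" using closure_subset[of ?B] by auto
  then show "cstar_generated (\<pi> ` cont_fun \<union> {U}) \<subseteq> closure ?B"
    unfolding cstar_generated_def
    using star_subalgebra_closure[OF star_subalgebra_eval] closed_closure by blast
  show "closure ?B \<subseteq> cstar_generated (\<pi> ` cont_fun \<union> {U})"
    unfolding cstar_generated_def
  proof (rule Inter_greatest)
    fix B assume "B \<in> {B. star_subalgebra B \<and> closed B \<and> \<pi> ` cont_fun \<union> {U} \<subseteq> B}"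
    then have B: "star_subalgebra B" "closed B" "\<And>a. a \<in> cont_fun \<Longrightarrow> \<pi> a \<in> B" "U \<in> B" by auto
    have ops: "0 \<in> B" "\<And>S T. S \<in> B \<Longrightarrow> T \<in> B \<Longrightarrow> S + T \<in> B" "\<And>S T. S \<in> B \<Longrightarrow> T \<in> B \<Longrightarrow> S * T \<in> B"
      "\<And>T. T \<in> B \<Longrightarrow> adj T \<in> B"
      using B(1) by (auto simp: star_subalgebra_def)
    have right: "T * U ^ l \<in> B" if "T \<in> B" for T l
    proof (induction l)
      case (Suc l)
      then show ?case using ops(3)[OF Suc B(4)] by (simp only: power_Suc2 mult.assoc)
    qed (simp add: that)
    have left: "adj U ^ k * T \<in> B" if "T \<in> B" for T k
    proof (induction k)
      case (Suc k)
      then show ?case using ops(3)[OF ops(4)[OF B(4)] Suc] by (simp only: power_Suc mult.assoc)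
    qed (simp add: that)
    have "eval_terms \<pi> U xs \<in> B" if "cont_terms xs" for xs
      using that
    proof (induction xs)
      case (Cons t xs)
      obtain k a l where t: "t = (k, a, l)" by (cases t)
      have "val t \<in> B"
        using left[OF right[OF B(3)]] Cons.prems by (simp add: t mono_val_def mult.assoc)
      then show ?case using Cons ops(2) by simp
    qed (simp add: ops)
    then show "closure ?B \<subseteq> B" using B(2) by (intro closure_minimal) auto
  qed
qed

text \<open>Each summand of the double sum becomes one triple of degree n, for negative n too, so
  the row n = 0 is exactly the degree 0 part. Listing the index pairs keeps coinciding triples as
  separate entries.\<close>

lemma property_star_of_norm_diag_le:
  assumes "\<And>xs. cont_terms xs \<Longrightarrow> norm (eval_terms \<pi> U (degree_part 0 xs)) \<le> norm (eval_terms \<pi> U xs)"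
  shows "property_star \<pi> U"
  unfolding property_star_def
proof (intro allI impI)
  fix M N :: nat and a :: "int \<Rightarrow> nat \<Rightarrow> 'x \<Rightarrow> complex"
  assume a: "\<forall>n\<in>{- int N..int N}. \<forall>k\<le>M. a n k \<in> cont_fun"
  define I where "I = List.product [- int N..int N] [0..<Suc M]"
  define xs where "xs = map (\<lambda>(n, k). mono_shift D \<alpha> n k (a n k)) I"
  have I: "distinct I" "set I = {- int N..int N} \<times> {..M}"
    by (auto simp: I_def distinct_product)
  have xs: "cont_terms xs"
    unfolding cont_terms_iff xs_def using a by (auto simp: I mono_shift_cont)
  have sum_I: "sum_list (map (\<lambda>(n, k). F n k) I) = (\<Sum>n = - int N..int N. \<Sum>k\<le>M. F n k)"
    for F :: "int \<Rightarrow> nat \<Rightarrow> 'h bop"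
    by (simp add: sum_list_distinct_conv_sum_set I sum.cartesian_product)
  have val: "val (mono_shift D \<alpha> n k (a n k)) = adj U ^ k * \<pi> (a n k) * U ^ k * zpow U n"
    if "n \<in> {- int N..int N}" "k \<le> M" for n k
    using a that by (intro val_shift) blast
  have "eval_terms \<pi> U xs = (\<Sum>n = - int N..int N. \<Sum>k\<le>M. val (mono_shift D \<alpha> n k (a n k)))"
    unfolding eval_terms_def xs_def by (simp add: sum_I[symmetric] comp_def split_def)
  also have "\<dots> = (\<Sum>n = - int N..int N. (\<Sum>k\<le>M. adj U ^ k * \<pi> (a n k) * U ^ k) * zpow U n)"
    unfolding sum_distrib_right by (intro sum.cong refl val) auto
  finally have eval: "eval_terms \<pi> U xs
    = (\<Sum>n = - int N..int N. (\<Sum>k\<le>M. adj U ^ k * \<pi> (a n k) * U ^ k) * zpow U n)" .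
  have part: "eval_terms \<pi> U (degree_part 0 ys)
      = sum_list (map (\<lambda>t. if mono_degree t = 0 then val t else 0) ys)" for ys
    by (induction ys) auto
  have "eval_terms \<pi> U (degree_part 0 xs)
      = (\<Sum>n = - int N..int N. \<Sum>k\<le>M. if n = 0 then val (mono_shift D \<alpha> n k (a n k)) else 0)"
    unfolding part xs_def by (simp add: sum_I[symmetric] comp_def split_def mono_degree_shift)
  also have "\<dots> = (\<Sum>n = - int N..int N. if n = 0 then \<Sum>k\<le>M. val (mono_shift D \<alpha> 0 k (a 0 k)) else 0)"
    by (rule sum.cong) auto
  also have "\<dots> = (\<Sum>k\<le>M. val (mono_shift D \<alpha> 0 k (a 0 k)))"
    by simp
  also have "\<dots> = (\<Sum>k\<le>M. adj U ^ k * \<pi> (a 0 k) * U ^ k)"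
    by (intro sum.cong refl) (simp add: val zpow_def)
  finally show "norm (\<Sum>k\<le>M. adj U ^ k * \<pi> (a 0 k) * U ^ k)
      \<le> norm (\<Sum>n = - int N..int N. (\<Sum>k\<le>M. adj U ^ k * \<pi> (a n k) * U ^ k) * zpow U n)"
    using assms[OF xs] by (simp only: eval)
qed

end

text \<open>The relation pairs the two evaluations of one list. Comparing norms in both directions
  makes it isometric, and the closures of its domain and range are the generated algebras.\<close>

theorem (in partial_system) cov_rep_isomorphism:
  fixes \<pi>\<^sub>1 :: "('x \<Rightarrow> complex) \<Rightarrow> 'h1::chilbert_space bop"
    and \<pi>\<^sub>2 :: "('x \<Rightarrow> complex) \<Rightarrow> 'h2::chilbert_space bop"
  assumes reps: "cov_rep D \<alpha> \<pi>\<^sub>1 U\<^sub>1" "cov_rep D \<alpha> \<pi>\<^sub>2 U\<^sub>2" and free: "topologically_free D \<alpha>"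
  shows "\<exists>\<Phi>. star_isomorphism \<Phi> (cstar_generated (\<pi>\<^sub>1 ` cont_fun \<union> {U\<^sub>1}))
      (cstar_generated (\<pi>\<^sub>2 ` cont_fun \<union> {U\<^sub>2}))
    \<and> \<Phi> U\<^sub>1 = U\<^sub>2 \<and> (\<forall>a\<in>cont_fun. \<Phi> (\<pi>\<^sub>1 a) = \<pi>\<^sub>2 a)"
proof -
  interpret r1: cov_rep D \<alpha> \<pi>\<^sub>1 U\<^sub>1 by fact
  interpret r2: cov_rep D \<alpha> \<pi>\<^sub>2 U\<^sub>2 by fact
  define R where "R S T \<longleftrightarrow> (\<exists>xs. cont_terms xs \<and> S = eval_terms \<pi>\<^sub>1 U\<^sub>1 xs \<and> T = eval_terms \<pi>\<^sub>2 U\<^sub>2 xs)"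
    for S T
  have RI: "R (eval_terms \<pi>\<^sub>1 U\<^sub>1 xs) (eval_terms \<pi>\<^sub>2 U\<^sub>2 xs)" if "cont_terms xs" for xs
    using that by (auto simp: R_def)
  have dom: "{S. \<exists>T. R S T} = {eval_terms \<pi>\<^sub>1 U\<^sub>1 xs |xs. cont_terms xs}"
    "{T. \<exists>S. R S T} = {eval_terms \<pi>\<^sub>2 U\<^sub>2 xs |xs. cont_terms xs}"
    by (auto simp: R_def)
  have "\<exists>\<Phi>. star_isomorphism \<Phi> (closure {S. \<exists>T. R S T}) (closure {T. \<exists>S. R S T})
    \<and> (\<forall>S T. R S T \<longrightarrow> \<Phi> S = T)"
  proof (rule star_isomorphism_of_isometric_relation)
    show "norm S = norm T" if "R S T" for S T
      using that norm_eval_mono[OF reps free] norm_eval_mono[OF reps(2,1) free]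
      unfolding R_def by (meson antisym)
    fix S T S' T' assume "R S T" "R S' T'"
    then obtain xs ys where xs: "cont_terms xs" "S = eval_terms \<pi>\<^sub>1 U\<^sub>1 xs" "T = eval_terms \<pi>\<^sub>2 U\<^sub>2 xs"
      and ys: "cont_terms ys" "S' = eval_terms \<pi>\<^sub>1 U\<^sub>1 ys" "T' = eval_terms \<pi>\<^sub>2 U\<^sub>2 ys"
      by (auto simp: R_def)
    show "R (S + S') (T + T')" using RI[of "xs @ ys"] xs ys by simp
    show "R (S * S') (T * T')"
      using RI[of "mult_terms D \<alpha> xs ys"] xs ys by (simp add: r1.eval_mult r2.eval_mult cont_terms_mult)
  next
    fix S T c assume "R S T"
    then obtain xs where xs: "cont_terms xs" "S = eval_terms \<pi>\<^sub>1 U\<^sub>1 xs" "T = eval_terms \<pi>\<^sub>2 U\<^sub>2 xs"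
      by (auto simp: R_def)
    show "R (c *\<^sub>C S) (c *\<^sub>C T)"
      using RI[of "map (mono_scale c) xs"] xs by (simp add: r1.eval_scale r2.eval_scale mono_scale_cont)
    show "R (adj S) (adj T)"
      using RI[of "map mono_adj xs"] xs by (simp add: r1.eval_adj r2.eval_adj cont_terms_adj)
  qed
  then obtain \<Phi> where \<Phi>: "star_isomorphism \<Phi> (closure {S. \<exists>T. R S T}) (closure {T. \<exists>S. R S T})"
    "\<And>S T. R S T \<Longrightarrow> \<Phi> S = T" by blast
  have "\<Phi> U\<^sub>1 = U\<^sub>2"
    using RI[of "[(0, \<lambda>x. 1, 1)]"] by (intro \<Phi>(2)) (simp add: mono_val_def r1.pi_one_U r2.pi_one_U)
  moreover have "\<Phi> (\<pi>\<^sub>1 a) = \<pi>\<^sub>2 a" if "a \<in> cont_fun" for a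
    using RI[of "[(0, a, 0)]"] that by (intro \<Phi>(2)) (simp add: mono_val_def)
  ultimately show ?thesis
    using \<Phi>(1) unfolding dom r1.cstar_generated_eq r2.cstar_generated_eq by blast
qed

theorem theorem6p11:
  fixes D :: "'x::t2_space set" and \<alpha> :: "'x \<Rightarrow> 'x"
  assumes "compact (UNIV :: 'x set)"
    and "open D" and "closed D"
    and "continuous_on D \<alpha>" and "open (\<alpha> ` D)"
    and "topologically_free D \<alpha>"
  shows "(\<forall>(\<pi> :: ('x \<Rightarrow> complex) \<Rightarrow> 'h::chilbert_space bop) U.
            cov_faith_rep D \<alpha> \<pi> U \<longrightarrow> property_star \<pi> U)
       \<and> (\<forall>(\<pi>\<^sub>1 :: ('x \<Rightarrow> complex) \<Rightarrow> 'h1::chilbert_space bop) U\<^sub>1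
            (\<pi>\<^sub>2 :: ('x \<Rightarrow> complex) \<Rightarrow> 'h2::chilbert_space bop) U\<^sub>2.
            cov_faith_rep D \<alpha> \<pi>\<^sub>1 U\<^sub>1 \<and> cov_faith_rep D \<alpha> \<pi>\<^sub>2 U\<^sub>2 \<longrightarrow>
            (\<exists>\<Phi>. star_isomorphism \<Phi>
                    (cstar_generated (\<pi>\<^sub>1 ` cont_fun \<union> {U\<^sub>1}))
                    (cstar_generated (\<pi>\<^sub>2 ` cont_fun \<union> {U\<^sub>2}))
                  \<and> \<Phi> U\<^sub>1 = U\<^sub>2 \<and> (\<forall>a\<in>cont_fun. \<Phi> (\<pi>\<^sub>1 a) = \<pi>\<^sub>2 a)))"
proof -
  interpret partial_system D \<alpha> by standard (use assms in auto)
  have rep: "cov_rep D \<alpha> \<pi> U" if "cov_faith_rep D \<alpha> \<pi> U"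
    for \<pi> :: "('x \<Rightarrow> complex) \<Rightarrow> 'k::chilbert_space bop" and U
    by standard (rule that)
  show ?thesis
  proof (intro conjI allI impI)
    fix \<pi> :: "('x \<Rightarrow> complex) \<Rightarrow> 'h bop" and U
    assume "cov_faith_rep D \<alpha> \<pi> U"
    then have r: "cov_rep D \<alpha> \<pi> U" by (rule rep)
    show "property_star \<pi> U"
      \<comment> \<open>The representation is compared with itself.\<close>
      by (rule cov_rep.property_star_of_norm_diag_le[OF r norm_diag_le_norm_eval[OF r r assms(6)]])
  next
    fix \<pi>\<^sub>1 :: "('x \<Rightarrow> complex) \<Rightarrow> 'h1 bop" and U\<^sub>1
      and \<pi>\<^sub>2 :: "('x \<Rightarrow> complex) \<Rightarrow> 'h2 bop" and U\<^sub>2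
    assume "cov_faith_rep D \<alpha> \<pi>\<^sub>1 U\<^sub>1 \<and> cov_faith_rep D \<alpha> \<pi>\<^sub>2 U\<^sub>2"
    then have r: "cov_rep D \<alpha> \<pi>\<^sub>1 U\<^sub>1" "cov_rep D \<alpha> \<pi>\<^sub>2 U\<^sub>2" by (auto intro: rep)
    show "\<exists>\<Phi>. star_isomorphism \<Phi> (cstar_generated (\<pi>\<^sub>1 ` cont_fun \<union> {U\<^sub>1}))
          (cstar_generated (\<pi>\<^sub>2 ` cont_fun \<union> {U\<^sub>2}))
        \<and> \<Phi> U\<^sub>1 = U\<^sub>2 \<and> (\<forall>a\<in>cont_fun. \<Phi> (\<pi>\<^sub>1 a) = \<pi>\<^sub>2 a)"
      by (rule cov_rep_isomorphism[OF r assms(6)])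
  qed
qed

end
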